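(* Let $k\ge 2$. Given a $k$-DFAO $M$ generating a $k$-automatic sequence ${\bf a}$, each of the following properties is decidable (i.e., there is an algorithm which, given $M$ and the indicated additional parameters, decides the property): (a) given a rational number $r>1$, whether ${\bf a}$ avoids $r$-powers (resp., avoids $r^+$-powers); (b) given a rational number $r>1$, whether ${\bf a}$ contains infinitely many occurrences of $r$-powers (resp., $r^+$-powers); (c) given a rational number $r>1$, whether ${\bf a}$ contains infinitely many distinct $r$-powers (resp., $r^+$-powers); (d) given a rational number $r>1$ and a length $l$, whether ${\bf a}$ avoids all $r$-powers $x^r$ (resp., all $r^+$-powers) with period word $x$ satisfying $|x|\ge l$; (e) given a rational number $r>1$, whether ${\bf a}$ avoids $x^r$ for all sufficiently long $x$; (f) given a length $l$, whether ${\bf a}$ avoids (i.e., has no factor that is a) palindrome of length $\ge l$; (g) whether ${\bf a}$ avoids all sufficiently long palindromes; (h) given a length $l$, whether ${\bf a}$ has the property that whenever $x$ is a factor of ${\bf a}$ of length $\ge l$, its reversal $x^R$ is not a factor of ${\bf a}$; (i) assuming ${\bf a}$ is over the alphabet $\{0,1,\ldots,j-1\}$, whether ${\bf a}$ has no factor of the form $x\,\sigma(x)$ with $x$ nonempty, where $\sigma$ is the morphism defined by $\sigma(a)=(a+1)\bmod j$ on letters.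
   Context: A $k$-DFAO is a deterministic finite automaton with output $M=(Q,\Sigma_k,\Delta,\delta,q_0,\tau)$, $\Sigma_k=\{0,\ldots,k-1\}$, $\delta:Q\times\Sigma_k\to Q$, $\tau:Q\to\Delta$; it generates $(a_n)_{n\ge0}$ with $a_n=\tau(\delta(q_0,w^R))$ for any base-$k$ representation $w$ of $n$ (leading zeros allowed), $w^R$ the reversal of $w$. For a real $\alpha>1$, a word $z$ is an $\alpha$-power (written $x^\alpha$) if for some nonempty word $x$ it is the shortest prefix of $x^\omega=xxx\cdots$ of length $\ge\alpha|x|$; it is an $\alpha^+$-power if it is the shortest prefix of $x^\omega$ of length $>\alpha|x|$. A word or sequence contains an $\alpha$-power if some factor (contiguous block) of it is an $\alpha$-power, and avoids $\alpha$-powers otherwise (similarly for $\alpha^+$-powers). A palindrome is a word equal to its reversal. *)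

theory Defs
  imports Complex_Main "HOL-Library.Nat_Bijection" "HOL-Library.Omega_Words_Fun"
begin

section \<open>Deterministic finite automata with output\<close>

record ('q, 'd) dfao =
  states :: "'q set"
  outputs :: "'d set"
  delta :: "'q \<Rightarrow> nat \<Rightarrow> 'q"
  start :: "'q"
  tau :: "'q \<Rightarrow> 'd"

definition is_dfao :: "nat \<Rightarrow> ('q, 'd) dfao \<Rightarrow> bool" where
  "is_dfao k M \<longleftrightarrow>
     finite (states M) \<and> finite (outputs M) \<and> start M \<in> states M \<and>
     (\<forall>q \<in> states M. \<forall>c < k. delta M q c \<in> states M) \<and>
     (\<forall>q \<in> states M. tau M q \<in> outputs M)"

text \<open>The base-\<open>k\<close> value of a digit word, most significant digit first.\<close>

definition base_value :: "nat \<Rightarrow> nat list \<Rightarrow> nat" where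
  "base_value k w = foldl (\<lambda>n d. n * k + d) 0 w"

text \<open>
  The quantification over all digit words \<open>w\<close>, including those with leading zeros, is
  a condition on \<open>M\<close>: an automaton whose output depends on the number of leading zeros
  generates no sequence.
\<close>

definition generates :: "nat \<Rightarrow> ('q, 'd) dfao \<Rightarrow> 'd word \<Rightarrow> bool" where
  "generates k M a \<longleftrightarrow>
     (\<forall>w. set w \<subseteq> {..<k} \<longrightarrow> a (base_value k w) = tau M (foldl (delta M) (start M) (rev w)))"

section \<open>Factors, powers and palindromes\<close>

definition factor :: "'a list \<Rightarrow> 'a word \<Rightarrow> bool" where
  "factor z a \<longleftrightarrow> (\<exists>i j. i \<le> j \<and> z = a [i \<rightarrow> j])"

definition power_of :: "real \<Rightarrow> 'a list \<Rightarrow> 'a list \<Rightarrow> bool" where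
  "power_of \<alpha> x z \<longleftrightarrow>
     x \<noteq> [] \<and> z = prefix (LEAST n. real n \<ge> \<alpha> * real (length x)) (x\<^sup>\<omega>)"

definition plus_power_of :: "real \<Rightarrow> 'a list \<Rightarrow> 'a list \<Rightarrow> bool" where
  "plus_power_of \<alpha> x z \<longleftrightarrow>
     x \<noteq> [] \<and> z = prefix (LEAST n. real n > \<alpha> * real (length x)) (x\<^sup>\<omega>)"

definition is_power :: "real \<Rightarrow> 'a list \<Rightarrow> bool" where
  "is_power \<alpha> z \<longleftrightarrow> (\<exists>x. power_of \<alpha> x z)"

definition is_plus_power :: "real \<Rightarrow> 'a list \<Rightarrow> bool" where
  "is_plus_power \<alpha> z \<longleftrightarrow> (\<exists>x. plus_power_of \<alpha> x z)"

definition avoids :: "('a list \<Rightarrow> bool) \<Rightarrow> 'a word \<Rightarrow> bool" where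
  "avoids P a \<longleftrightarrow> \<not> (\<exists>z. factor z a \<and> P z)"

text \<open>An occurrence of a factor is identified with its start and end positions.\<close>

definition occurrences :: "('a list \<Rightarrow> bool) \<Rightarrow> 'a word \<Rightarrow> (nat \<times> nat) set" where
  "occurrences P a = {(i, j). i \<le> j \<and> P (a [i \<rightarrow> j])}"

definition palindrome :: "'a list \<Rightarrow> bool" where
  "palindrome z \<longleftrightarrow> rev z = z"

section \<open>Recursive functions and decidability\<close>

text \<open>
  The total recursive functions, with minimization applied to regular functions only.
  A function of arity \<open>n\<close> is a function on lists, of which only the values on lists of
  length \<open>n\<close> are meaningful.
\<close>

inductive recursive :: "nat \<Rightarrow> (nat list \<Rightarrow> nat) \<Rightarrow> bool" where
  zero: "recursive n (\<lambda>xs. 0)"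
| succ: "recursive 1 (\<lambda>xs. Suc (xs ! 0))"
| proj: "i < n \<Longrightarrow> recursive n (\<lambda>xs. xs ! i)"
| comp: "recursive (length fs) g \<Longrightarrow> (\<forall>f \<in> set fs. recursive n f) \<Longrightarrow>
    recursive n (\<lambda>xs. g (map (\<lambda>f. f xs) fs))"
| prim_rec: "recursive n g \<Longrightarrow> recursive (n + 2) h \<Longrightarrow>
    recursive (n + 1) (\<lambda>xs. rec_nat (g (tl xs)) (\<lambda>y v. h (y # v # tl xs)) (hd xs))"
| minimize: "recursive (n + 1) f \<Longrightarrow> (\<forall>xs. length xs = n \<longrightarrow> (\<exists>y. f (y # xs) = 0)) \<Longrightarrow>
    recursive n (\<lambda>xs. LEAST y. f (y # xs) = 0)"

text \<open>
  An automaton is presented to an algorithm with its states numbered \<open>0, 1, \<dots>, m - 1\<close>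
  and natural numbers as output letters. Its code lists the number of states, the output
  alphabet, the table of \<open>delta\<close> (one row per state), the start state and the table of \<open>tau\<close>.
\<close>

definition numbered :: "(nat, nat) dfao \<Rightarrow> bool" where
  "numbered M \<longleftrightarrow> states M = {..<card (states M)}"

definition dfao_code :: "nat \<Rightarrow> (nat, nat) dfao \<Rightarrow> nat" where
  "dfao_code k M = (let m = card (states M) in
     list_encode
       [m,
        set_encode (outputs M),
        list_encode (map (\<lambda>q. list_encode (map (delta M q) [0..<k])) [0..<m]),
        start M,
        list_encode (map (tau M) [0..<m])])"

text \<open>Numerator and denominator in lowest terms; used for positive rationals only.\<close>

definition rat_code :: "rat \<Rightarrow> nat list" where
  "rat_code r = (case quotient_of r of (p, q) \<Rightarrow> [nat p, nat q])"

text \<open>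
  There is an algorithm that is given a \<open>k\<close>-DFAO \<open>M\<close> and a parameter \<open>p\<close> (in the encoding
  \<open>enc\<close>) and decides whether the sequence \<open>a\<close> generated by \<open>M\<close> satisfies \<open>P p a\<close>, for all
  inputs that meet the standing assumption \<open>A p a\<close>. The algorithm depends on \<open>k\<close>, but it
  sees \<open>a\<close> only through \<open>M\<close>.
\<close>

definition decidable_for_dfaos ::
  "nat \<Rightarrow> ('p \<Rightarrow> nat list) \<Rightarrow> ('p \<Rightarrow> nat word \<Rightarrow> bool) \<Rightarrow> ('p \<Rightarrow> nat word \<Rightarrow> bool) \<Rightarrow> bool" where
  "decidable_for_dfaos k enc A P \<longleftrightarrow>
     (\<exists>n f. recursive (Suc n) f \<and>
        (\<forall>M a p. is_dfao k M \<and> numbered M \<and> generates k M a \<and> A p a \<longrightarrow>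
           length (enc p) = n \<and>
           f (dfao_code k M # enc p) = (if P p a then 1 else 0)))"

end

theory Submission
  imports Defs
begin

text \<open>
  For a function \<open>f\<close> of natural number arguments, consider the functions obtained from it by fixing the
  last \<open>i\<close> base-\<open>k\<close> digits of all arguments. For an automatic sequence and for linear inequalities
  there are finitely many of them, and a bound on their number is computable from the automaton and
  the coefficients. Boolean connectives multiply such bounds, and a quantifier turns a bound \<open>N\<close>
  into \<open>2 ^ N\<close>. By pumping, a quantified variable need only range over numbers below
  \<open>k ^ (N + s)\<close>, where all free variables are below \<open>k ^ s\<close>. Hence every first-order property of the
  sequence with addition is equivalent to one with computably bounded quantifiers, which is evaluated
  directly: no automaton for a compound formula is ever constructed. All properties of the theorem are
  of this kind.
\<close>

section \<open>Computable functions\<close>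

text \<open>Decidability asks for one recursive function that serves all \<open>M\<close>, so the
  existence of an automaton for each formula and each \<open>M\<close> would not suffice; it would
  have to be built on codes, inside \<open>recursive\<close>. Therefore each formula carries two
  recursive functions of the input: an evaluator and a bound on the number of residuals. Both arise
  from those of the subformulas by arithmetic, and the residuals themselves occur only in statements
  about the bound. Digits are fixed from the least significant end because addition then hands on
  only a carry, which is bounded independently of the number of digits read. The numerator and
  denominator of \<open>r\<close> become coefficients: they are constants for each single input, so
  the inequalities stay linear although the coefficients vary with the input. Infinitude becomes
  first-order as unboundedness of a position or of a length.\<close>

text \<open>Only the values on lists of length \<open>n\<close> are constrained, so that equal functions may be
  exchanged freely on those lists.\<close>

definition computable :: "nat \<Rightarrow> (nat list \<Rightarrow> nat) \<Rightarrow> bool" where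
  "computable n f \<longleftrightarrow> (\<exists>g. recursive n g \<and> (\<forall>xs. length xs = n \<longrightarrow> f xs = g xs))"

lemma computable_cong:
  assumes "computable n f" "\<And>xs. length xs = n \<Longrightarrow> g xs = f xs"
  shows "computable n g"
  using assms unfolding computable_def by metis

section \<open>Substitution and primitive recursion\<close>

lemma computable_compose:
  assumes "computable (length fs) g" "\<And>f. f \<in> set fs \<Longrightarrow> computable n f"
  shows "computable n (\<lambda>xs. g (map (\<lambda>f. f xs) fs))"
proof -
  obtain g' where g': "recursive (length fs) g'" "\<And>xs. length xs = length fs \<Longrightarrow> g xs = g' xs"
    using assms(1) unfolding computable_def by blast
  have "\<forall>f \<in> set fs. \<exists>f'. recursive n f' \<and> (\<forall>xs. length xs = n \<longrightarrow> f xs = f' xs)"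
    using assms(2) unfolding computable_def by blast
  then obtain F where F: "\<And>f. f \<in> set fs \<Longrightarrow> recursive n (F f)"
      "\<And>f xs. f \<in> set fs \<Longrightarrow> length xs = n \<Longrightarrow> f xs = F f xs"
    using bchoice[of "set fs" "\<lambda>f f'. recursive n f' \<and> (\<forall>xs. length xs = n \<longrightarrow> f xs = f' xs)"]
    by blast
  have "recursive n (\<lambda>xs. g' (map (\<lambda>f. f xs) (map F fs)))"
    by (rule recursive.comp) (use g'(1) F(1) in auto)
  moreover have "g (map (\<lambda>f. f xs) fs) = g' (map (\<lambda>f. f xs) (map F fs))" if "length xs = n" for xs
  proof -
    have "map (\<lambda>f. f xs) fs = map (\<lambda>f. f xs) (map F fs)"
      using F(2) that by simp
    then show ?thesis using g'(2) by (metis length_map)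
  qed
  ultimately show ?thesis unfolding computable_def by blast
qed

lemma computable_nth: "i < n \<Longrightarrow> computable n (\<lambda>xs. xs ! i)"
  unfolding computable_def using recursive.proj by blast

lemma computable_Suc:
  assumes "computable n f"
  shows "computable n (\<lambda>xs. Suc (f xs))"
proof -
  have "computable (length [f]) (\<lambda>xs. Suc (xs ! 0))"
    unfolding computable_def using recursive.succ by auto
  from computable_compose[OF this, of n] assms show ?thesis by simp
qed

lemma computable_const: "computable n (\<lambda>xs. c)"
proof (induction c)
  case 0
  then show ?case unfolding computable_def using recursive.zero by blast
next
  case (Suc c)
  then show ?case by (rule computable_Suc)
qed

text \<open>Dropping and rearranging arguments are instances, with projections substituted for all
  arguments.\<close>

lemma computable_reindex:
  assumes "computable m f" "\<And>i. i < m \<Longrightarrow> g i < n"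
  shows "computable n (\<lambda>xs. f (map (\<lambda>i. xs ! g i) [0..<m]))"
proof -
  have "computable n (\<lambda>xs. f (map (\<lambda>h. h xs) (map (\<lambda>i xs. xs ! g i) [0..<m])))"
    by (rule computable_compose) (use assms in \<open>auto intro: computable_nth\<close>)
  then show ?thesis by (simp add: comp_def)
qed

lemma computable_drop:
  assumes "computable m f"
  shows "computable (n + m) (\<lambda>xs. f (drop n xs))"
  by (rule computable_cong[OF computable_reindex[OF assms, of "\<lambda>i. n + i"]])
    (auto intro!: arg_cong[of _ _ f] nth_equalityI)

lemma computable_tl: "computable n f \<Longrightarrow> computable (Suc n) (\<lambda>xs. f (tl xs))"
  using computable_drop[of n f 1] by (simp add: drop_Suc)

lemma computable_nth_drop:
  assumes "j + i < n"
  shows "computable n (\<lambda>xs. drop j xs ! i)"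
  by (rule computable_cong[OF computable_nth[OF assms]]) (use assms in auto)

lemma computable_nth_tl: "Suc i < n \<Longrightarrow> computable n (\<lambda>xs. tl xs ! i)"
  using computable_nth_drop[of 1 i n] by (simp add: drop_Suc)

lemma computable_hd: "0 < n \<Longrightarrow> computable n hd"
  by (rule computable_cong[OF computable_nth]) (auto simp: hd_conv_nth)

lemma computable_Cons:
  assumes "computable (Suc n) f" "computable n g"
  shows "computable n (\<lambda>xs. f (g xs # xs))"
proof -
  have "computable n (\<lambda>xs. f (map (\<lambda>h. h xs) (g # map (\<lambda>i xs. xs ! i) [0..<n])))"
    by (rule computable_compose) (use assms in \<open>auto intro: computable_nth\<close>)
  then show ?thesis
    by (rule computable_cong) (auto simp: comp_def intro!: arg_cong[of _ _ f] nth_equalityI)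
qed

text \<open>The constructor \<open>prim_rec\<close> recurses on the first argument. Substituting
  \<open>b xs\<close> for it afterwards allows a computed recursion depth while the step still sees
  all of \<open>xs\<close>.\<close>

lemma computable_rec_nat:
  assumes "computable n g" "computable (n + 2) (\<lambda>zs. h (zs ! 0) (zs ! 1) (drop 2 zs))"
    "computable n b"
  shows "computable n (\<lambda>xs. rec_nat (g xs) (\<lambda>y v. h y v xs) (b xs))"
proof -
  obtain g' where g': "recursive n g'" "\<And>xs. length xs = n \<Longrightarrow> g xs = g' xs"
    using assms(1) unfolding computable_def by blast
  obtain h' where h': "recursive (n + 2) h'"
      "\<And>zs. length zs = n + 2 \<Longrightarrow> h (zs ! 0) (zs ! 1) (drop 2 zs) = h' zs"
    using assms(2) unfolding computable_def by blast
  have h: "h y v xs = h' (y # v # xs)" if "length xs = n" for y v xs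
    using h'(2)[of "y # v # xs"] that by simp
  have "computable (Suc n) (\<lambda>xs. rec_nat (g' (tl xs)) (\<lambda>y v. h' (y # v # tl xs)) (hd xs))"
    unfolding computable_def using recursive.prim_rec[OF g'(1) h'(1)] by auto
  from computable_Cons[OF this assms(3)] show ?thesis
    by (rule computable_cong) (simp add: g'(2) h)
qed

lemma computable1:
  assumes "computable 1 (\<lambda>xs. h (xs ! 0))" "computable n f"
  shows "computable n (\<lambda>xs. h (f xs))"
  using computable_compose[of "[f]" "\<lambda>xs. h (xs ! 0)" n] assms by simp

text \<open>By this rule an arithmetic operation has to be defined by recursion only for two bare
  projections.\<close>

lemma computable2:
  assumes "computable 2 (\<lambda>xs. h (xs ! 0) (xs ! 1))" "computable n f" "computable n g"
  shows "computable n (\<lambda>xs. h (f xs) (g xs))"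
  using computable_compose[of "[f, g]" "\<lambda>xs. h (xs ! 0) (xs ! 1)" n] assms
  by (auto simp: numeral_2_eq_2)

section \<open>Arithmetic and truth values\<close>

lemma computable_add:
  assumes "computable n f" "computable n g"
  shows "computable n (\<lambda>xs. f xs + g xs)"
proof (rule computable2[OF _ assms])
  have "computable 2 (\<lambda>xs. rec_nat (xs ! 1) (\<lambda>y v. Suc v) (xs ! 0))"
    by (rule computable_rec_nat) (auto intro!: computable_nth computable_Suc)
  moreover have "rec_nat y (\<lambda>_ v. Suc v) x = x + y" for x y :: nat
    by (induction x) auto
  ultimately show "computable 2 (\<lambda>xs. xs ! 0 + xs ! 1)" by simp
qed

lemma computable_mult:
  assumes "computable n f" "computable n g"
  shows "computable n (\<lambda>xs. f xs * g xs)"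
proof (rule computable2[OF _ assms])
  have "computable 2 (\<lambda>xs. rec_nat 0 (\<lambda>y v. v + xs ! 1) (xs ! 0))"
    by (rule computable_rec_nat)
      (auto intro!: computable_nth computable_const computable_add computable_nth_drop)
  moreover have "rec_nat 0 (\<lambda>_ v. v + y) x = x * y" for x y :: nat
    by (induction x) auto
  ultimately show "computable 2 (\<lambda>xs. xs ! 0 * xs ! 1)" by simp
qed

lemma computable_power:
  assumes "computable n f" "computable n g"
  shows "computable n (\<lambda>xs. f xs ^ g xs)"
proof (rule computable2[OF _ assms])
  have "computable 2 (\<lambda>xs. rec_nat 1 (\<lambda>y v. xs ! 0 * v) (xs ! 1))"
    by (rule computable_rec_nat)
      (auto intro!: computable_nth computable_const computable_mult computable_nth_drop)
  moreover have "rec_nat 1 (\<lambda>_ v. x * v) y = x ^ y" for x y :: nat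
    by (induction y) auto
  ultimately show "computable 2 (\<lambda>xs. xs ! 0 ^ xs ! 1)" by simp
qed

lemma computable_diff:
  assumes "computable n f" "computable n g"
  shows "computable n (\<lambda>xs. f xs - g xs)"
proof (rule computable2[OF _ assms])
  \<comment> \<open>The predecessor: the step ignores the recursive value and returns the
    counter.\<close>
  have "computable 1 (\<lambda>xs. rec_nat 0 (\<lambda>y v. y) (xs ! 0))"
    by (rule computable_rec_nat) (auto intro!: computable_nth computable_const)
  moreover have "rec_nat 0 (\<lambda>y v. y) x = x - 1" for x
    by (cases x) auto
  ultimately have pred: "computable 1 (\<lambda>xs. xs ! 0 - 1)" by simp
  have "computable 2 (\<lambda>xs. rec_nat (xs ! 0) (\<lambda>y v. v - 1) (xs ! 1))"
    by (rule computable_rec_nat) (rule computable_nth computable1[OF pred] | simp)+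
  moreover have "rec_nat x (\<lambda>y v. v - 1) y = x - y" for x y :: nat
    by (induction y) auto
  ultimately show "computable 2 (\<lambda>xs. xs ! 0 - xs ! 1)" by simp
qed

lemma computable_not: "computable n (\<lambda>xs. of_bool (P xs)) \<Longrightarrow> computable n (\<lambda>xs. of_bool (\<not> P xs))"
  by (rule computable_cong[OF computable_diff[OF computable_const[of n 1]]]) auto

lemma computable_conj:
  "computable n (\<lambda>xs. of_bool (P xs)) \<Longrightarrow> computable n (\<lambda>xs. of_bool (Q xs)) \<Longrightarrow>
    computable n (\<lambda>xs. of_bool (P xs \<and> Q xs))"
  by (rule computable_cong[OF computable_mult]) (auto simp: of_bool_conj)

text \<open>Subtraction is truncated, so \<open>1 - (f xs - g xs)\<close> is the truth
  value.\<close>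

lemma computable_le:
  "computable n f \<Longrightarrow> computable n g \<Longrightarrow> computable n (\<lambda>xs. of_bool (f xs \<le> g xs))"
  by (rule computable_cong[OF computable_diff[OF computable_const[of n 1] computable_diff[of n f g]]])
    auto

lemma computable_eq:
  "computable n f \<Longrightarrow> computable n g \<Longrightarrow> computable n (\<lambda>xs. of_bool (f xs = g xs))"
  using computable_conj[OF computable_le[of n f g] computable_le[of n g f]]
  by (simp add: order_eq_iff[of "f _"])

lemma computable_if:
  assumes "computable n (\<lambda>xs. of_bool (P xs))" "computable n f" "computable n g"
  shows "computable n (\<lambda>xs. if P xs then f xs else g xs)"
  by (rule computable_cong[OF computable_add[OF computable_mult[OF assms(1,2)]
    computable_mult[OF computable_not[OF assms(1)] assms(3)]]]) auto

lemma computable_mod: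
  assumes "computable n f" "computable n g"
  shows "computable n (\<lambda>xs. f xs mod g xs)"
proof (rule computable2[OF _ assms])
  \<comment> \<open>A counter that is reset on reaching the divisor. For divisor 0 it is never
    reset, in agreement with \<open>x mod 0 = x\<close>.\<close>
  have "computable 2 (\<lambda>xs. rec_nat 0 (\<lambda>y v. if Suc v = xs ! 1 then 0 else Suc v) (xs ! 0))"
    by (rule computable_rec_nat) (auto intro!: computable_nth computable_const computable_nth_drop
      computable_if computable_eq computable_Suc)
  moreover have "rec_nat 0 (\<lambda>_ v. if Suc v = y then 0 else Suc v) x = x mod y" for x y :: nat
    by (induction x) (auto simp: mod_Suc)
  ultimately show "computable 2 (\<lambda>xs. xs ! 0 mod xs ! 1)" by simp
qed

lemma computable_div:
  assumes "computable n f" "computable n g"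
  shows "computable n (\<lambda>xs. f xs div g xs)"
proof (rule computable2[OF _ assms])
  \<comment> \<open>Counts the resets of the counter that computes \<open>mod\<close>; with divisor
    0 there are none.\<close>
  have "computable 2 (\<lambda>xs. rec_nat 0 (\<lambda>y v. if Suc (y mod xs ! 1) = xs ! 1 then Suc v else v) (xs ! 0))"
    by (rule computable_rec_nat) (auto intro!: computable_nth computable_const computable_nth_drop
      computable_if computable_eq computable_Suc computable_mod)
  moreover have "rec_nat 0 (\<lambda>z v. if Suc (z mod y) = y then Suc v else v) x = x div y" for x y :: nat
    by (induction x) (auto simp: div_Suc mod_Suc)
  ultimately show "computable 2 (\<lambda>xs. xs ! 0 div xs ! 1)" by simp
qed

section \<open>Bounded sums and bounded search\<close>

lemma computable_sum:
  assumes "computable (Suc n) (\<lambda>zs. f (hd zs) (tl zs))" "computable n b"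
  shows "computable n (\<lambda>xs. \<Sum>y<b xs. f y xs)"
proof -
  \<comment> \<open>The recursion step receives \<open>y # v # xs\<close>, but the summand expects
    \<open>y # xs\<close>; the index map skips the accumulator at position 1.\<close>
  have "computable (n + 2) (\<lambda>zs. (\<lambda>zs. f (hd zs) (tl zs)) (map (\<lambda>i. zs ! (if i = 0 then 0 else Suc i)) [0..<Suc n]))"
    by (rule computable_reindex[OF assms(1)]) auto
  then have f: "computable (n + 2) (\<lambda>zs. f (zs ! 0) (drop 2 zs))"
    by (rule computable_cong)
      (auto simp: upt_rec[of 0] nth_append simp del: upt_Suc intro!: arg_cong[of _ _ "f _"] nth_equalityI)
  have "computable n (\<lambda>xs. rec_nat 0 (\<lambda>y v. v + f y xs) (b xs))"
    by (rule computable_rec_nat) (auto intro!: computable_const computable_add f[simplified] computable_nth assms(2))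
  moreover have "rec_nat 0 (\<lambda>y v. v + f y xs) m = (\<Sum>y<m. f y xs)" for m xs
    by (induction m) auto
  ultimately show ?thesis by simp
qed

lemma computable_bounded_ex:
  assumes "computable (Suc n) (\<lambda>zs. of_bool (P (hd zs) (tl zs)))" "computable n b"
  shows "computable n (\<lambda>xs. of_bool (\<exists>y<b xs. P y xs))"
proof -
  have "computable n (\<lambda>xs. of_bool (1 \<le> (\<Sum>y<b xs. of_bool (P y xs) :: nat)))"
    by (intro computable_le computable_sum computable_const assms)
  then show ?thesis
    by (rule computable_cong) (force simp: Suc_le_eq)
qed

text \<open>This sum \<open>s\<close> will be the exponent for which all free variables are below
  \<open>k ^ s\<close>: each entry is at most \<open>s\<close>, and
  \<open>s < k ^ s\<close>.\<close>

lemma computable_sum_entries: "computable n (\<lambda>xs. \<Sum>i<n. xs ! i)"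
proof -
  have "computable n (\<lambda>xs. \<Sum>i<j. xs ! i)" if "j \<le> n" for j
    using that by (induction j) (auto intro!: computable_const computable_add computable_nth)
  then show ?thesis by simp
qed

section \<open>Pairs and coded lists\<close>

lemma computable_prod_encode:
  assumes "computable n f" "computable n g"
  shows "computable n (\<lambda>xs. prod_encode (f xs, g xs))"
  unfolding prod_encode_def triangle_def prod.case
  by (intro computable_add computable_div computable_mult computable_Suc computable_const assms)

text \<open>A bounded double sum with a single nonzero term serves as a search for the preimage.\<close>

lemma sum_prod_encode_preimage:
  "(\<Sum>m<Suc z. \<Sum>n<Suc z. of_bool (prod_encode (m, n) = z) * h m n) =
    (h (fst (prod_decode z)) (snd (prod_decode z)) :: nat)"
proof -
  obtain a b where ab: "prod_decode z = (a, b)" by (cases "prod_decode z")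
  then have z: "z = prod_encode (a, b)" by (metis prod_decode_inverse)
  then have le: "a < Suc z" "b < Suc z"
    using le_prod_encode_1[of a b] le_prod_encode_2[of b a] by simp_all
  have "(\<Sum>n<Suc z. of_bool (prod_encode (m, n) = z) * h m n) = (if m = a then h a b else 0)" for m
  proof -
    have "(\<Sum>n<Suc z. of_bool (prod_encode (m, n) = z) * h m n) =
        (\<Sum>n<Suc z. if n = b then of_bool (m = a) * h m n else 0)"
      by (rule sum.cong) (auto simp: z)
    then show ?thesis using le(2) by (simp del: sum.lessThan_Suc)
  qed
  then have "(\<Sum>m<Suc z. \<Sum>n<Suc z. of_bool (prod_encode (m, n) = z) * h m n) =
      (\<Sum>m<Suc z. if m = a then h a b else 0)" by simp
  also have "\<dots> = h a b" using le(1) by (simp del: sum.lessThan_Suc)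
  finally show ?thesis using ab by simp
qed

text \<open>A decoded pair is not a number, so its components are handed to a numerical
  \<open>h\<close>; choosing \<open>h\<close> as a projection yields each component.\<close>

lemma computable_prod_decode:
  assumes h: "computable 2 (\<lambda>xs. h (xs ! 0) (xs ! 1))" and f: "computable n f"
  shows "computable n (\<lambda>xs. h (fst (prod_decode (f xs))) (snd (prod_decode (f xs))))"
proof (rule computable1[OF _ f])
  have inner: "computable 2 (\<lambda>xs. \<Sum>n<Suc (xs ! 1). of_bool (prod_encode (xs ! 0, n) = xs ! 1) * h (xs ! 0) n)"
    by (intro computable_sum computable_mult computable_eq computable_prod_encode computable2[OF h]
      computable_Suc computable_nth computable_nth_tl computable_hd) auto
  have "computable 1 (\<lambda>xs. \<Sum>m<Suc (xs ! 0). \<Sum>n<Suc (xs ! 0). of_bool (prod_encode (m, n) = xs ! 0) * h m n)"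
    by (rule computable_sum, rule computable2[OF inner])
      (intro computable_nth_tl computable_hd computable_Suc computable_nth; simp)+
  then show "computable 1 (\<lambda>xs. h (fst (prod_decode (xs ! 0))) (snd (prod_decode (xs ! 0))))"
    unfolding sum_prod_encode_preimage .
qed

text \<open>As \<open>list_encode (x # xs)\<close> is
  \<open>Suc (prod_encode (x, list_encode xs))\<close>, the map
  \<open>snd (prod_decode (v - 1))\<close> passes to the tail.\<close>

definition encoded_nth :: "nat \<Rightarrow> nat \<Rightarrow> nat" where
  "encoded_nth c i = fst (prod_decode (rec_nat c (\<lambda>_ v. snd (prod_decode (v - 1))) i - 1))"

lemma encoded_nth: "i < length xs \<Longrightarrow> encoded_nth (list_encode xs) i = xs ! i"
proof -
  assume i: "i < length xs"
  have "rec_nat (list_encode xs) (\<lambda>_ v. snd (prod_decode (v - 1))) i = list_encode (drop i xs)"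
    using i
  proof (induction i)
    case (Suc i)
    then have "drop i xs = xs ! i # drop (Suc i) xs" by (simp add: Cons_nth_drop_Suc)
    with Suc show ?case by simp
  qed simp
  moreover have "drop i xs = xs ! i # drop (Suc i) xs" using i by (simp add: Cons_nth_drop_Suc)
  ultimately show ?thesis unfolding encoded_nth_def by simp
qed

lemma computable_encoded_nth:
  assumes "computable n f" "computable n g"
  shows "computable n (\<lambda>xs. encoded_nth (f xs) (g xs))"
proof (rule computable2[OF _ assms])
  have fst: "computable 2 (\<lambda>xs. xs ! 0)" and snd: "computable 2 (\<lambda>xs. xs ! 1)"
    by (auto intro: computable_nth)
  have "computable 2 (\<lambda>xs. rec_nat (xs ! 0) (\<lambda>_ v. snd (prod_decode (v - 1))) (xs ! 1))"
    by (rule computable_rec_nat)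
      (auto intro!: computable_nth computable_diff computable_const computable_prod_decode[OF snd, simplified])
  then show "computable 2 (\<lambda>xs. encoded_nth (xs ! 0) (xs ! 1))"
    unfolding encoded_nth_def
    by (intro computable_diff computable_const computable_prod_decode[OF fst])
qed

section \<open>Kernels\<close>

text \<open>For \<open>f\<close> depending on one argument this is the usual \<open>k\<close>-kernel of a sequence. In general its
  members are the residual functions after reading \<open>i\<close> digits of each argument, least significant
  first, so the size of the kernel is the number of states of a minimal automaton for \<open>f\<close>.\<close>

definition kernel :: "nat \<Rightarrow> ((nat \<Rightarrow> nat) \<Rightarrow> 'b) \<Rightarrow> ((nat \<Rightarrow> nat) \<Rightarrow> 'b) set" where
  "kernel k f = {\<lambda>e. f (\<lambda>v. k ^ i * e v + r v) | i r. \<forall>v. r v < k ^ i}"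

text \<open>Finiteness is demanded separately because \<open>card\<close> of an infinite set is
  0.\<close>

definition index_le :: "nat \<Rightarrow> ((nat \<Rightarrow> nat) \<Rightarrow> 'b) \<Rightarrow> nat \<Rightarrow> bool" where
  "index_le k f N \<longleftrightarrow> finite (kernel k f) \<and> card (kernel k f) \<le> N"

lemma kernelI: "\<forall>v. r v < k ^ i \<Longrightarrow> (\<lambda>e. f (\<lambda>v. k ^ i * e v + r v)) \<in> kernel k f"
  unfolding kernel_def by blast

lemma index_leI:
  assumes "finite F" "card F \<le> N"
    "\<And>i r. \<forall>v. r v < k ^ i \<Longrightarrow> (\<lambda>e. f (\<lambda>v. k ^ i * e v + r v)) \<in> F"
  shows "index_le k f N"
proof -
  have "kernel k f \<subseteq> F" using assms(3) unfolding kernel_def by blast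
  then show ?thesis
    unfolding index_le_def using assms(1,2) by (meson card_mono finite_subset le_trans)
qed

section \<open>Pointwise operations and projection\<close>

lemma index_le_const: "index_le k (\<lambda>e. c) 1"
  by (rule index_leI[of "{\<lambda>e. c}"]) auto

lemma index_le_comp:
  assumes "index_le k f N"
  shows "index_le k (\<lambda>e. h (f e)) N"
proof (rule index_leI[of "(\<lambda>g e. h (g e)) ` kernel k f"])
  show "card ((\<lambda>g e. h (g e)) ` kernel k f) \<le> N"
    using assms unfolding index_le_def by (meson card_image_le le_trans)
qed (use assms kernelI[of _ k _ f] in \<open>auto simp: index_le_def\<close>)

text \<open>The product construction: a residual of the combination is determined by the residuals
  of \<open>f\<close> and \<open>g\<close> for the same \<open>i\<close> and
  \<open>r\<close>.\<close>

lemma index_le_comp2: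
  assumes "index_le k f N" "index_le k g M"
  shows "index_le k (\<lambda>e. h (f e) (g e)) (N * M)"
proof (rule index_leI)
  let ?F = "(\<lambda>(f', g') e. h (f' e) (g' e)) ` (kernel k f \<times> kernel k g)"
  show "finite ?F" using assms by (simp add: index_le_def)
  have "card ?F \<le> card (kernel k f \<times> kernel k g)"
    by (rule card_image_le) (use assms in \<open>simp add: index_le_def\<close>)
  also have "\<dots> \<le> N * M"
    unfolding card_cartesian_product by (intro mult_le_mono) (use assms in \<open>simp_all add: index_le_def\<close>)
  finally show "card ?F \<le> N * M" .
  fix i and r :: "nat \<Rightarrow> nat" assume r: "\<forall>v. r v < k ^ i"
  show "(\<lambda>e. h (f (\<lambda>v. k ^ i * e v + r v)) (g (\<lambda>v. k ^ i * e v + r v))) \<in> ?F"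
    by (rule image_eqI[OF _ SigmaI[OF kernelI[OF r, of f] kernelI[OF r, of g]]]) simp
qed

text \<open>In \<open>case_nat x e\<close> the new variable has number 0. Fixing digits of it and of
  the old variables are compatible, with quotient \<open>x\<close> and remainder
  \<open>s\<close>.\<close>

lemma case_nat_shift:
  "(\<lambda>v. c * case_nat x e v + case_nat s r v) = case_nat (c * x + s) (\<lambda>v. c * e v + r v :: nat)"
  by (rule ext) (simp split: nat.split)

text \<open>Writing the quantified \<open>x\<close> as \<open>k ^ i * x' + s\<close> turns each residual of the projection into
  a disjunction of projected residuals of \<open>R\<close>, as in the subset construction.\<close>

lemma index_le_ex:
  assumes k: "k > 0" and R: "index_le k R N"
  shows "index_le k (\<lambda>e. \<exists>x. R (case_nat x e)) (2 ^ N)"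
proof (rule index_leI)
  let ?F = "(\<lambda>T e. \<exists>g\<in>T. \<exists>x. g (case_nat x e)) ` Pow (kernel k R)"
  have fin: "finite (kernel k R)" and card: "card (kernel k R) \<le> N"
    using R by (simp_all add: index_le_def)
  show "finite ?F" using fin by simp
  have "card ?F \<le> card (Pow (kernel k R))" using fin by (intro card_image_le) simp
  also have "\<dots> \<le> 2 ^ N" using card fin by (simp add: card_Pow)
  finally show "card ?F \<le> 2 ^ N" .
  fix i and r :: "nat \<Rightarrow> nat" assume r: "\<forall>v. r v < k ^ i"
  define G where "G s = (\<lambda>e. R (\<lambda>v. k ^ i * e v + case_nat s r v))" for s
  have "(\<exists>x. R (case_nat x (\<lambda>v. k ^ i * e v + r v))) \<longleftrightarrow> (\<exists>g\<in>G ` {..<k ^ i}. \<exists>x. g (case_nat x e))" for e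
  proof
    assume "\<exists>x. R (case_nat x (\<lambda>v. k ^ i * e v + r v))"
    then obtain x where x: "R (case_nat x (\<lambda>v. k ^ i * e v + r v))" ..
    have "G (x mod k ^ i) (case_nat (x div k ^ i) e)"
      using x unfolding G_def case_nat_shift by simp
    moreover have "x mod k ^ i < k ^ i" using k by simp
    ultimately show "\<exists>g\<in>G ` {..<k ^ i}. \<exists>x. g (case_nat x e)" by blast
  next
    assume "\<exists>g\<in>G ` {..<k ^ i}. \<exists>x. g (case_nat x e)"
    then show "\<exists>x. R (case_nat x (\<lambda>v. k ^ i * e v + r v))"
      unfolding G_def by (auto simp: case_nat_shift)
  qed
  moreover have "G ` {..<k ^ i} \<subseteq> kernel k R"
  proof clarify
    fix s assume "s < k ^ i"
    then have "\<forall>v. case_nat s r v < k ^ i" using r by (simp split: nat.split)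
    then show "G s \<in> kernel k R" unfolding G_def by (rule kernelI)
  qed
  ultimately show "(\<lambda>e. \<exists>x. R (case_nat x (\<lambda>v. k ^ i * e v + r v))) \<in> ?F"
    by (intro image_eqI[of _ _ "G ` {..<k ^ i}"]) auto
qed

text \<open>Pumping: among the residuals of \<open>R\<close> after \<open>s, s + 1, \<dots>, s + N\<close> digits two coincide, and the
  digits of a large witness between these two positions can be cut out.\<close>

lemma bounded_witness:
  assumes k: "k \<ge> 2" and R: "index_le k R N" and e: "\<forall>v. e v < k ^ s"
    and ex: "\<exists>x. R (case_nat x e)"
  shows "\<exists>x < k ^ (N + s). R (case_nat x e)"
proof -
  define x where "x = (LEAST x. R (case_nat x e))"
  have x: "R (case_nat x e)" unfolding x_def using ex by (rule LeastI_ex)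
  have least: "x \<le> y" if "R (case_nat y e)" for y unfolding x_def using that by (rule Least_le)
  \<comment> \<open>The free variables are exhausted after \<open>s\<close> digits: they serve as
    remainders, with quotient 0, and only \<open>x\<close> has digits left.\<close>
  define Q where "Q j = (\<lambda>e'. R (\<lambda>v. k ^ (s + j) * e' v + case_nat (x mod k ^ (s + j)) e v))" for j
  have Q: "Q j (case_nat y (\<lambda>_. 0)) = R (case_nat (k ^ (s + j) * y + x mod k ^ (s + j)) e)" for j y
    unfolding Q_def case_nat_shift by simp
  have "Q j \<in> kernel k R" for j
  proof -
    have "e v < k ^ (s + j)" for v
      by (rule less_le_trans[OF spec[OF e]]) (use k in \<open>simp add: power_increasing\<close>)
    then have "\<forall>v. case_nat (x mod k ^ (s + j)) e v < k ^ (s + j)"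
      using k by (simp split: nat.split)
    then show ?thesis unfolding Q_def by (rule kernelI)
  qed
  then have "Q ` {..N} \<subseteq> kernel k R" by blast
  then have "card (Q ` {..N}) \<le> N"
    using R unfolding index_le_def by (meson card_mono le_trans)
  then have "\<not> inj_on Q {..N}" by (intro pigeonhole) simp
  then obtain i j where ij: "i < j" "j \<le> N" "Q i = Q j"
    unfolding inj_on_def by (metis atMost_iff linorder_neqE_nat)
  have "x < k ^ (N + s)"
  proof (rule ccontr)
    assume "\<not> x < k ^ (N + s)"
    moreover have "k ^ (s + i) \<le> k ^ (N + s)" using k ij by (intro power_increasing) auto
    ultimately have "k ^ (s + i) \<le> x" by linarith
    \<comment> \<open>Cutting out digits makes \<open>x\<close> smaller only if a nonzero part lies
      above them; this is where \<open>x \<ge> k ^ (N + s)\<close> enters.\<close>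
    then have pos: "0 < x div k ^ (s + i)" using k by (simp add: div_greater_zero_iff)
    have "x div k ^ (s + j) = x div k ^ (s + i) div k ^ (j - i)"
      using ij by (simp add: div_mult2_eq[symmetric] power_add[symmetric])
    also have "\<dots> < x div k ^ (s + i)"
      using one_less_power[of k "j - i"] k ij by (intro div_less_dividend[OF _ pos]) simp
    finally have "k ^ (s + i) * (x div k ^ (s + j)) < k ^ (s + i) * (x div k ^ (s + i))"
      using k by simp
    then have "k ^ (s + i) * (x div k ^ (s + j)) + x mod k ^ (s + i) < x"
      using mult_div_mod_eq[of "k ^ (s + i)" x] by linarith
    moreover have "R (case_nat (k ^ (s + i) * (x div k ^ (s + j)) + x mod k ^ (s + i)) e)"
      using x Q[of j "x div k ^ (s + j)"] Q[of i "x div k ^ (s + j)"] ij(3) by simp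
    ultimately show False using least by fastforce
  qed
  then show ?thesis using x by blast
qed

section \<open>Linear terms\<close>

text \<open>Satisfied by \<open>t e = \<Sum> c_v * e v + c\<close>: there \<open>g\<close> is the
  homogeneous part, and \<open>W\<close> can be the sum of the coefficients and of \<open>c\<close>.
  The second condition bounds the carry \<open>t r div k ^ i\<close> by \<open>W\<close> for every
  \<open>i\<close>.\<close>

definition affine :: "nat \<Rightarrow> ((nat \<Rightarrow> nat) \<Rightarrow> nat) \<Rightarrow> nat \<Rightarrow> bool" where
  "affine k t W \<longleftrightarrow> (\<exists>g. \<forall>i e r. t (\<lambda>v. k ^ i * e v + r v) = k ^ i * g e + t r) \<and>
     (\<forall>i r. (\<forall>v. r v < k ^ i) \<longrightarrow> t r \<le> W * k ^ i)"

lemma affineI: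
  assumes "\<And>i e r. t (\<lambda>v. k ^ i * e v + r v) = k ^ i * g e + t r"
    "\<And>i r. \<forall>v. r v < k ^ i \<Longrightarrow> t r \<le> W * k ^ i"
  shows "affine k t W"
  unfolding affine_def using assms by (auto intro!: exI[of _ g])

lemma affine_var: "affine k (\<lambda>e. e v) 1"
  unfolding affine_def by (auto intro: exI[of _ "\<lambda>e. e v"] less_imp_le)

lemma affine_const: "k > 0 \<Longrightarrow> affine k (\<lambda>e. c) c"
  unfolding affine_def by (auto intro: exI[of _ "\<lambda>e. 0"])

lemma affine_add:
  assumes "affine k t W" "affine k t' W'"
  shows "affine k (\<lambda>e. t e + t' e) (W + W')"
proof -
  obtain g where g: "\<And>i e r. t (\<lambda>v. k ^ i * e v + r v) = k ^ i * g e + t r"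
    using assms(1) unfolding affine_def by blast
  obtain g' where g': "\<And>i e r. t' (\<lambda>v. k ^ i * e v + r v) = k ^ i * g' e + t' r"
    using assms(2) unfolding affine_def by blast
  have "t (\<lambda>v. k ^ i * e v + r v) + t' (\<lambda>v. k ^ i * e v + r v) = k ^ i * (g e + g' e) + (t r + t' r)" for i e r
    unfolding g g' by (simp add: algebra_simps)
  moreover have "t r + t' r \<le> (W + W') * k ^ i" if "\<forall>v. r v < k ^ i" for r i
    using assms that unfolding affine_def by (simp add: add_mono distrib_right)
  ultimately show ?thesis by (rule affineI)
qed

lemma affine_cmult:
  assumes "affine k t W"
  shows "affine k (\<lambda>e. c * t e) (c * W)"
proof -
  obtain g where g: "\<And>i e r. t (\<lambda>v. k ^ i * e v + r v) = k ^ i * g e + t r"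
    using assms unfolding affine_def by blast
  have "c * t (\<lambda>v. k ^ i * e v + r v) = k ^ i * (c * g e) + c * t r" for i e r
    unfolding g by (simp add: algebra_simps)
  moreover have "c * t r \<le> c * W * k ^ i" if "\<forall>v. r v < k ^ i" for r i
    using assms that unfolding affine_def by (simp add: mult.assoc)
  ultimately show ?thesis by (rule affineI)
qed

text \<open>After division by \<open>k ^ i\<close> the inequality compares the homogeneous parts,
  and the digits read survive only in the floor of \<open>(t r - s r) / k ^ i\<close>. This floor
  lies between \<open>- W\<close> and \<open>W'\<close>, which leaves \<open>W + W' + 1\<close>
  values.\<close>

lemma index_le_affine_le:
  assumes k: "k > 0" and "affine k s W" "affine k t W'"
  shows "index_le k (\<lambda>e. s e \<le> t e) (W + W' + 1)"
proof -
  obtain g where g: "\<And>i e r. s (\<lambda>v. k ^ i * e v + r v) = k ^ i * g e + s r"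
    and W: "\<And>i r. \<forall>v. r v < k ^ i \<Longrightarrow> s r \<le> W * k ^ i"
    using assms(2) unfolding affine_def by blast
  obtain g' where g': "\<And>i e r. t (\<lambda>v. k ^ i * e v + r v) = k ^ i * g' e + t r"
    and W': "\<And>i r. \<forall>v. r v < k ^ i \<Longrightarrow> t r \<le> W' * k ^ i"
    using assms(3) unfolding affine_def by blast
  let ?F = "(\<lambda>z e. int (g e) - int (g' e) \<le> z) ` {- int W .. int W'}"
  show ?thesis
  proof (rule index_leI)
    show "card ?F \<le> W + W' + 1"
      by (rule le_trans[OF card_image_le]) auto
    fix i and r :: "nat \<Rightarrow> nat" assume r: "\<forall>v. r v < k ^ i"
    define z where "z = (int (t r) - int (s r)) div int (k ^ i)"
    have pos: "0 < int (k ^ i)" using k by simp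
    have "s (\<lambda>v. k ^ i * e v + r v) \<le> t (\<lambda>v. k ^ i * e v + r v) \<longleftrightarrow> int (g e) - int (g' e) \<le> z" for e
    proof -
      have "s (\<lambda>v. k ^ i * e v + r v) \<le> t (\<lambda>v. k ^ i * e v + r v) \<longleftrightarrow>
          int (k ^ i * g e + s r) \<le> int (k ^ i * g' e + t r)"
        unfolding g g' by (rule of_nat_le_iff[symmetric])
      also have "\<dots> \<longleftrightarrow> (int (g e) - int (g' e)) * int (k ^ i) \<le> int (t r) - int (s r)"
        unfolding of_nat_add of_nat_mult left_diff_distrib by (simp add: mult.commute) linarith
      also have "\<dots> \<longleftrightarrow> int (g e) - int (g' e) \<le> z"
      proof
        assume "(int (g e) - int (g' e)) * int (k ^ i) \<le> int (t r) - int (s r)"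
        from zdiv_mono1[OF this pos] show "int (g e) - int (g' e) \<le> z"
          unfolding z_def using k by simp
      next
        assume "int (g e) - int (g' e) \<le> z"
        then have "(int (g e) - int (g' e)) * int (k ^ i) \<le> z * int (k ^ i)"
          using pos by (intro mult_right_mono) auto
        also have "\<dots> \<le> int (t r) - int (s r)"
          using pos mult_div_mod_eq[of "int (k ^ i)" "int (t r) - int (s r)"]
            pos_mod_sign[OF pos, of "int (t r) - int (s r)"]
          unfolding z_def mult.commute[of _ "int (k ^ i)"] by linarith
        finally show "(int (g e) - int (g' e)) * int (k ^ i) \<le> int (t r) - int (s r)" .
      qed
      finally show ?thesis .
    qed
    moreover have "z \<in> {- int W .. int W'}"
    proof -
      have b: "int (s r) \<le> int W * int (k ^ i)" "int (t r) \<le> int W' * int (k ^ i)"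
        using W[OF r] W'[OF r] unfolding of_nat_mult[symmetric] of_nat_le_iff by simp_all
      have "- int W * int (k ^ i) div int (k ^ i) \<le> z"
        unfolding z_def by (rule zdiv_mono1[OF _ pos]) (use b in simp)
      moreover have "z \<le> int W' * int (k ^ i) div int (k ^ i)"
        unfolding z_def by (rule zdiv_mono1[OF _ pos]) (use b in simp)
      ultimately show ?thesis
        using pos by (metis atLeastAtMost_iff nonzero_mult_div_cancel_right order_less_irrefl)
    qed
    ultimately show "(\<lambda>e. s (\<lambda>v. k ^ i * e v + r v) \<le> t (\<lambda>v. k ^ i * e v + r v)) \<in> ?F"
      by blast
  qed simp
qed

text \<open>The digits read from the variables fix the low \<open>i\<close> digits of
  \<open>t e\<close> and a carry of at most \<open>W\<close>. Hence a residual is given by a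
  residual of \<open>a\<close> and one of \<open>W + 1\<close> carries.\<close>

lemma index_le_affine_comp:
  assumes k: "k > 0" and a: "index_le k (\<lambda>e. a (e 0)) N" and t: "affine k t W"
  shows "index_le k (\<lambda>e. a (t e)) (N * (W + 1))"
proof -
  obtain g where g: "\<And>i e r. t (\<lambda>v. k ^ i * e v + r v) = k ^ i * g e + t r"
    and W: "\<And>i r. \<forall>v. r v < k ^ i \<Longrightarrow> t r \<le> W * k ^ i"
    using t unfolding affine_def by blast
  let ?K = "kernel k (\<lambda>e. a (e 0))"
  let ?F = "(\<lambda>(b, c) e. b (\<lambda>_. g e + c)) ` (?K \<times> {..W})"
  have fin: "finite ?K" "card ?K \<le> N" using a by (simp_all add: index_le_def)
  show ?thesis
  proof (rule index_leI)
    show "finite ?F" using fin by simp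
    have "card ?F \<le> card (?K \<times> {..W})" using fin by (intro card_image_le) simp
    also have "\<dots> \<le> N * (W + 1)" 
      unfolding card_cartesian_product using fin by (intro mult_le_mono) simp_all
    finally show "card ?F \<le> N * (W + 1)" .
    fix i and r :: "nat \<Rightarrow> nat" assume r: "\<forall>v. r v < k ^ i"
    define b where "b = (\<lambda>e :: nat \<Rightarrow> nat. a (k ^ i * e 0 + t r mod k ^ i))"
    have "b \<in> ?K"
      using kernelI[of "\<lambda>_. t r mod k ^ i" k i "\<lambda>e. a (e 0)"] k unfolding b_def by simp
    moreover have "t r div k ^ i \<le> W"
      using div_le_mono[OF W[OF r], of "k ^ i"] k by simp
    moreover have "a (t (\<lambda>v. k ^ i * e v + r v)) = b (\<lambda>_. g e + t r div k ^ i)" for e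
      unfolding b_def g by (simp add: algebra_simps)
    ultimately show "(\<lambda>e. a (t (\<lambda>v. k ^ i * e v + r v))) \<in> ?F"
      by (intro image_eqI[of _ _ "(b, t r div k ^ i)"]) auto
  qed
qed

section \<open>Evaluating an automaton\<close>

text \<open>Least significant digit first, the order in which \<open>M\<close> reads; padded with
  zeros or cut off to length \<open>t\<close>.\<close>

definition digits :: "nat \<Rightarrow> nat \<Rightarrow> nat \<Rightarrow> nat list" where
  "digits k t x = map (\<lambda>i. x div k ^ i mod k) [0..<t]"

lemma base_value_append: "base_value k (u @ v) = base_value k u * k ^ length v + base_value k v"
proof (induction v rule: rev_induct)
  case (snoc c v)
  then show ?case by (simp add: base_value_def algebra_simps flip: append_assoc)
qed (simp add: base_value_def)

lemma base_value_digits: "base_value k (rev (digits k t x)) = x mod k ^ t"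
proof (induction t)
  case (Suc t)
  have "base_value k (rev (digits k (Suc t) x)) = x div k ^ t mod k * k ^ t + x mod k ^ t"
    using Suc base_value_append[of k "[x div k ^ t mod k]" "rev (digits k t x)"]
    by (simp add: digits_def) (simp add: base_value_def)
  also have "\<dots> = x mod k ^ Suc t"
    using mod_mult2_eq[of x "k ^ t" k] by (simp add: mult.commute)
  finally show ?case .
qed (simp add: digits_def base_value_def)

lemma set_digits: "k > 0 \<Longrightarrow> set (digits k t x) \<subseteq> {..<k}"
  by (auto simp: digits_def)

lemma generates_eval:
  assumes k: "k \<ge> 2" and gen: "generates k M a" and r: "r < k ^ i"
  shows "a (k ^ i * x + r) =
    tau M (foldl (delta M) (foldl (delta M) (start M) (digits k i r)) (digits k x x))"
proof -
  let ?w = "rev (digits k x x) @ rev (digits k i r)"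
  have "x < k ^ x" using k by (metis less_exp power_mono le_trans less_le_trans zero_le_numeral)
  then have "base_value k ?w = k ^ i * x + r"
    using r by (simp add: base_value_append base_value_digits) (simp add: digits_def)
  moreover have "set ?w \<subseteq> {..<k}" using set_digits[of k] k by simp
  ultimately show ?thesis using gen unfolding generates_def by (metis foldl_append rev_append rev_rev_ident)
qed

lemma foldl_delta_states:
  assumes "is_dfao k M" "q \<in> states M" "set w \<subseteq> {..<k}"
  shows "foldl (delta M) q w \<in> states M"
  using assms(2,3) by (induction w arbitrary: q) (use assms(1) in \<open>auto simp: is_dfao_def\<close>)

text \<open>A residual depends only on the state reached after the \<open>i\<close> digits of
  \<open>r 0\<close>.\<close>

lemma index_le_automatic:
  assumes k: "k \<ge> 2" and M: "is_dfao k M" and gen: "generates k M a"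
  shows "index_le k (\<lambda>e. a (e 0)) (card (states M))"
proof (rule index_leI)
  let ?F = "(\<lambda>q e. tau M (foldl (delta M) q (digits k (e 0) (e 0)))) ` states M"
  have fin: "finite (states M)" using M by (simp add: is_dfao_def)
  then show "finite ?F" "card ?F \<le> card (states M)" by (auto intro: card_image_le)
  fix i and r :: "nat \<Rightarrow> nat" assume r: "\<forall>v. r v < k ^ i"
  show "(\<lambda>e. a (k ^ i * e 0 + r 0)) \<in> ?F"
    unfolding generates_eval[OF k gen spec[OF r, of 0]]
    by (intro image_eqI[OF refl] foldl_delta_states[OF M] set_digits)
      (use k M in \<open>auto simp: is_dfao_def\<close>)
qed

text \<open>In \<open>dfao_code\<close>, entry 2 is the transition table, entry 3 the start state
  and entry 4 the output table.\<close>

definition run_code :: "nat \<Rightarrow> nat \<Rightarrow> nat \<Rightarrow> nat \<Rightarrow> nat" where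
  "run_code k c x t = rec_nat (encoded_nth c 3)
     (\<lambda>i q. encoded_nth (encoded_nth (encoded_nth c 2) q) (x div k ^ i mod k)) t"

definition eval_code :: "nat \<Rightarrow> nat \<Rightarrow> nat \<Rightarrow> nat" where
  "eval_code k c x = encoded_nth (encoded_nth c 4) (run_code k c x x)"

lemma computable_eval_code:
  assumes "computable n f" "computable n g"
  shows "computable n (\<lambda>xs. eval_code k (f xs) (g xs))"
proof (rule computable2[OF _ assms])
  have "computable 2 (\<lambda>xs. run_code k (xs ! 0) (xs ! 1) (xs ! 1))"
    unfolding run_code_def
    by (rule computable_rec_nat) (auto intro!: computable_encoded_nth computable_mod computable_div
        computable_power computable_nth computable_nth_drop computable_const)
  then show "computable 2 (\<lambda>xs. eval_code k (xs ! 0) (xs ! 1))"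
    unfolding eval_code_def by (auto intro!: computable_encoded_nth computable_nth computable_const)
qed

lemma encoded_nth_dfao_code:
  "encoded_nth (dfao_code k M) 0 = card (states M)"
  "encoded_nth (dfao_code k M) 2 =
    list_encode (map (\<lambda>q. list_encode (map (delta M q) [0..<k])) [0..<card (states M)])"
  "encoded_nth (dfao_code k M) 3 = start M"
  "encoded_nth (dfao_code k M) 4 = list_encode (map (tau M) [0..<card (states M)])"
  unfolding dfao_code_def Let_def by (subst encoded_nth; simp)+

lemma eval_code:
  assumes k: "k \<ge> 2" and M: "is_dfao k M" and num: "numbered M" and gen: "generates k M a"
  shows "eval_code k (dfao_code k M) x = a x"
proof -
  have states: "q < card (states M) \<longleftrightarrow> q \<in> states M" for q
    using num unfolding numbered_def by blast
  \<comment> \<open>Keeps all table look-ups in range, outside of which \<open>encoded_nth\<close>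
    is meaningless.\<close>
  have mem: "foldl (delta M) (start M) (digits k t x) < card (states M)" for t
    unfolding states by (rule foldl_delta_states[OF M]) (use set_digits k M in \<open>auto simp: is_dfao_def\<close>)
  have run: "run_code k (dfao_code k M) x t = foldl (delta M) (start M) (digits k t x)" for t
  proof (induction t)
    case (Suc t)
    have "run_code k (dfao_code k M) x (Suc t) = encoded_nth (encoded_nth (encoded_nth (dfao_code k M) 2)
        (run_code k (dfao_code k M) x t)) (x div k ^ t mod k)"
      by (simp add: run_code_def)
    also have "\<dots> = delta M (foldl (delta M) (start M) (digits k t x)) (x div k ^ t mod k)"
      using Suc mem[of t] k by (simp add: encoded_nth_dfao_code encoded_nth)
    finally show ?case by (simp add: digits_def)
  qed (simp add: run_code_def encoded_nth_dfao_code digits_def)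
  have "a x = tau M (foldl (delta M) (start M) (digits k x x))"
    using generates_eval[OF k gen, of 0 0 x] by (simp add: digits_def)
  then show ?thesis
    unfolding eval_code_def run encoded_nth_dfao_code using mem[of x] by (simp add: encoded_nth)
qed

section \<open>Uniformly definable properties\<close>

text \<open>The default 0 gives all variables a common bound, as \<open>bounded_witness\<close>
  requires.\<close>

definition env :: "nat list \<Rightarrow> nat \<Rightarrow> nat" where
  "env xs v = (if v < length xs then xs ! v else 0)"

lemma env_Cons: "env (x # xs) = case_nat x (env xs)"
  by (rule ext) (simp add: env_def split: nat.split)

text \<open>\<open>V\<close> is the set of valid inputs and \<open>ins i\<close> what the algorithm sees of the input \<open>i\<close>.\<close>

locale input_family =
  fixes k :: nat and V :: "'i set" and ins :: "'i \<Rightarrow> nat list" and m :: nat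
    and seq :: "'i \<Rightarrow> nat word"
  assumes k_ge_2: "k \<ge> 2"
    and length_ins: "i \<in> V \<Longrightarrow> length (ins i) = m"
    and ex_eval: "\<exists>f. computable (Suc m) f \<and> (\<forall>i\<in>V. \<forall>x. f (x # ins i) = seq i x)"
    and ex_index: "\<exists>N. computable m N \<and> (\<forall>i\<in>V. index_le k (\<lambda>e. seq i (e 0)) (N (ins i)))"
begin

lemma k_pos: "k > 0" using k_ge_2 by simp

definition computable_param :: "('i \<Rightarrow> nat) \<Rightarrow> bool" where
  "computable_param c \<longleftrightarrow> (\<exists>f. computable m f \<and> (\<forall>i\<in>V. f (ins i) = c i))"

text \<open>Uniformity lies in the order of quantifiers: \<open>f\<close> and \<open>W\<close>
  precede the input \<open>i\<close>. The weight \<open>W\<close> sees the input but not the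
  variables.\<close>

definition affine_term :: "nat \<Rightarrow> ('i \<Rightarrow> (nat \<Rightarrow> nat) \<Rightarrow> nat) \<Rightarrow> bool" where
  "affine_term n t \<longleftrightarrow> (\<exists>f W. computable (n + m) f \<and> computable m W \<and>
     (\<forall>i\<in>V. affine k (t i) (W (ins i)) \<and> (\<forall>xs. length xs = n \<longrightarrow> f (xs @ ins i) = t i (env xs))))"

definition definable_value :: "nat \<Rightarrow> ('i \<Rightarrow> (nat \<Rightarrow> nat) \<Rightarrow> nat) \<Rightarrow> bool" where
  "definable_value n t \<longleftrightarrow> (\<exists>f N. computable (n + m) f \<and> computable m N \<and>
     (\<forall>i\<in>V. index_le k (t i) (N (ins i)) \<and> (\<forall>xs. length xs = n \<longrightarrow> f (xs @ ins i) = t i (env xs))))"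

text \<open>With truth values as numbers, formulas and letters of the sequence share the closure
  rules of \<open>definable_value\<close>.\<close>

definition definable :: "nat \<Rightarrow> ('i \<Rightarrow> (nat \<Rightarrow> nat) \<Rightarrow> bool) \<Rightarrow> bool" where
  "definable n P \<longleftrightarrow> definable_value n (\<lambda>i e. of_bool (P i e))"

lemma affine_termI:
  assumes "computable (n + m) f" "computable m W" "\<And>i. i \<in> V \<Longrightarrow> affine k (t i) (W (ins i))"
    "\<And>i xs. i \<in> V \<Longrightarrow> length xs = n \<Longrightarrow> f (xs @ ins i) = t i (env xs)"
  shows "affine_term n t"
  unfolding affine_term_def using assms by blast

lemma definable_valueI:
  assumes "computable (n + m) f" "computable m N" "\<And>i. i \<in> V \<Longrightarrow> index_le k (t i) (N (ins i))"
    "\<And>i xs. i \<in> V \<Longrightarrow> length xs = n \<Longrightarrow> f (xs @ ins i) = t i (env xs)"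
  shows "definable_value n t"
  unfolding definable_value_def using assms by blast

section \<open>Closure rules for terms and formulas\<close>

lemma computable_param_const: "computable_param (\<lambda>i. c)"
  unfolding computable_param_def using computable_const by blast

lemma affine_term_var:
  assumes "v < n"
  shows "affine_term n (\<lambda>i e. e v)"
  unfolding affine_term_def
  using assms computable_nth[of v "n + m"] computable_const[of m 1] affine_var[of k v]
  by (intro exI[of _ "\<lambda>xs. xs ! v"] exI[of _ "\<lambda>xs. 1"]) (simp add: nth_append env_def)

lemma affine_term_param:
  assumes "computable_param c"
  shows "affine_term n (\<lambda>i e. c i)"
proof -
  obtain f where f: "computable m f" "\<And>i. i \<in> V \<Longrightarrow> f (ins i) = c i"
    using assms unfolding computable_param_def by blast
  show ?thesis
    by (rule affine_termI[where f = "\<lambda>xs. f (drop n xs)" and W = f])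
      (use f computable_drop[OF f(1), of n] affine_const[OF k_pos] in simp_all)
qed

lemma affine_term_add:
  assumes "affine_term n s" "affine_term n t"
  shows "affine_term n (\<lambda>i e. s i e + t i e)"
proof -
  obtain f W where f: "computable (n + m) f" "computable m W" "\<And>i. i \<in> V \<Longrightarrow> affine k (s i) (W (ins i))"
      "\<And>i xs. i \<in> V \<Longrightarrow> length xs = n \<Longrightarrow> f (xs @ ins i) = s i (env xs)"
    using assms(1) unfolding affine_term_def by blast
  obtain g U where g: "computable (n + m) g" "computable m U" "\<And>i. i \<in> V \<Longrightarrow> affine k (t i) (U (ins i))"
      "\<And>i xs. i \<in> V \<Longrightarrow> length xs = n \<Longrightarrow> g (xs @ ins i) = t i (env xs)"
    using assms(2) unfolding affine_term_def by blast
  show ?thesis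
    by (rule affine_termI[where f = "\<lambda>xs. f xs + g xs" and W = "\<lambda>xs. W xs + U xs"])
      (use f g computable_add[OF f(1) g(1)] computable_add[OF f(2) g(2)] in \<open>simp_all add: affine_add\<close>)
qed

text \<open>Weakening: below a quantifier, variable 0 is the bound one and all others move up.
  Formulas with arbitrary terms as arguments need this.\<close>

lemma affine_term_Suc:
  assumes "affine_term n t"
  shows "affine_term (Suc n) (\<lambda>i e. t i (\<lambda>v. e (Suc v)))"
proof -
  obtain f W where f: "computable (n + m) f" "computable m W" "\<And>i. i \<in> V \<Longrightarrow> affine k (t i) (W (ins i))"
      "\<And>i xs. i \<in> V \<Longrightarrow> length xs = n \<Longrightarrow> f (xs @ ins i) = t i (env xs)"
    using assms unfolding affine_term_def by blast
  show ?thesis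
  proof (rule affine_termI)
    show "computable (Suc n + m) (\<lambda>xs. f (tl xs))" using computable_tl[OF f(1)] by simp
    show "affine k (\<lambda>e. t i (\<lambda>v. e (Suc v))) (W (ins i))" if i: "i \<in> V" for i
    proof -
      obtain g where "\<And>j e r. t i (\<lambda>v. k ^ j * e v + r v) = k ^ j * g e + t i r"
        using f(3)[OF i] unfolding affine_def by blast
      then show ?thesis
        by (intro affineI[where g = "\<lambda>e. g (\<lambda>v. e (Suc v))"])
          (use f(3)[OF i] in \<open>auto simp: affine_def\<close>)
    qed
    show "f (tl (xs @ ins i)) = t i (\<lambda>v. env xs (Suc v))" if "i \<in> V" "length xs = Suc n" for i xs
      using f(4)[OF that(1), of "tl xs"] that(2) by (cases xs) (auto simp: env_Cons)
  qed (rule f(2))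
qed

text \<open>The factor is constant for each input, so the term stays linear; only the weight grows,
  computably in the input.\<close>

lemma affine_term_cmult:
  assumes "computable_param c" "affine_term n t"
  shows "affine_term n (\<lambda>i e. c i * t i e)"
proof -
  obtain f where f: "computable m f" "\<And>i. i \<in> V \<Longrightarrow> f (ins i) = c i"
    using assms unfolding computable_param_def by blast
  obtain g U where g: "computable (n + m) g" "computable m U" "\<And>i. i \<in> V \<Longrightarrow> affine k (t i) (U (ins i))"
      "\<And>i xs. i \<in> V \<Longrightarrow> length xs = n \<Longrightarrow> g (xs @ ins i) = t i (env xs)"
    using assms(2) unfolding affine_term_def by blast
  have "affine k (\<lambda>e. c i * t i e) (f (ins i) * U (ins i))" if "i \<in> V" for i
    using affine_cmult[OF g(3)[OF that]] f(2)[OF that] by simp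
  then show ?thesis
    by (intro affine_termI[where f = "\<lambda>xs. f (drop n xs) * g xs" and W = "\<lambda>xs. f xs * U xs"])
      (use f g computable_mult[OF computable_drop[OF f(1), of n] g(1)] computable_mult[OF f(1) g(2)] in simp_all)
qed

lemma definable_le:
  assumes "affine_term n s" "affine_term n t"
  shows "definable n (\<lambda>i e. s i e \<le> t i e)"
proof -
  obtain f W where f: "computable (n + m) f" "computable m W" "\<And>i. i \<in> V \<Longrightarrow> affine k (s i) (W (ins i))"
      "\<And>i xs. i \<in> V \<Longrightarrow> length xs = n \<Longrightarrow> f (xs @ ins i) = s i (env xs)"
    using assms(1) unfolding affine_term_def by blast
  obtain g U where g: "computable (n + m) g" "computable m U" "\<And>i. i \<in> V \<Longrightarrow> affine k (t i) (U (ins i))"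
      "\<And>i xs. i \<in> V \<Longrightarrow> length xs = n \<Longrightarrow> g (xs @ ins i) = t i (env xs)"
    using assms(2) unfolding affine_term_def by blast
  have "computable m (\<lambda>xs. W xs + U xs + 1)"
    by (intro computable_add computable_const f g)
  moreover have "index_le k (\<lambda>e. of_bool (s i e \<le> t i e)) (W (ins i) + U (ins i) + 1)" if "i \<in> V" for i
    by (rule index_le_comp[OF index_le_affine_le[OF k_pos f(3)[OF that] g(3)[OF that]]])
  ultimately show ?thesis
    unfolding definable_def
    by (intro definable_valueI[where f = "\<lambda>xs. of_bool (f xs \<le> g xs)" and N = "\<lambda>xs. W xs + U xs + 1"])
      (use f(4) g(4) computable_le[OF f(1) g(1)] in simp_all)
qed

lemma definable_value_param:
  assumes "computable_param c"
  shows "definable_value n (\<lambda>i e. c i)"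
proof -
  obtain f where f: "computable m f" "\<And>i. i \<in> V \<Longrightarrow> f (ins i) = c i"
    using assms unfolding computable_param_def by blast
  show ?thesis
    by (rule definable_valueI[where f = "\<lambda>xs. f (drop n xs)" and N = "\<lambda>_. 1"])
      (use f computable_drop[OF f(1), of n] computable_const[of m 1] index_le_const[of k] in simp_all)
qed

lemma definable_value_seq:
  assumes "affine_term n t"
  shows "definable_value n (\<lambda>i e. seq i (t i e))"
proof -
  obtain f W where f: "computable (n + m) f" "computable m W" "\<And>i. i \<in> V \<Longrightarrow> affine k (t i) (W (ins i))"
      "\<And>i xs. i \<in> V \<Longrightarrow> length xs = n \<Longrightarrow> f (xs @ ins i) = t i (env xs)"
    using assms(1) unfolding affine_term_def by blast
  obtain g where g: "computable (Suc m) g" "\<And>i x. i \<in> V \<Longrightarrow> g (x # ins i) = seq i x"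
    using ex_eval by blast
  obtain N where N: "computable m N" "\<And>i. i \<in> V \<Longrightarrow> index_le k (\<lambda>e. seq i (e 0)) (N (ins i))"
    using ex_index by blast
  have "computable (n + m) (\<lambda>xs. g (map (\<lambda>h. h xs) (f # map (\<lambda>j xs. xs ! (n + j)) [0..<m])))"
    by (rule computable_compose) (use f g in \<open>auto intro: computable_nth\<close>)
  then have "computable (n + m) (\<lambda>xs. g (f xs # drop n xs))"
    by (rule computable_cong) (auto simp: comp_def intro!: arg_cong[of _ _ g] nth_equalityI)
  moreover have "computable m (\<lambda>xs. N xs * (W xs + 1))"
    by (intro computable_add computable_mult computable_const f N)
  moreover have "index_le k (\<lambda>e. seq i (t i e)) (N (ins i) * (W (ins i) + 1))" if "i \<in> V" for i
    by (rule index_le_affine_comp[OF k_pos N(2)[OF that] f(3)[OF that]])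
  ultimately show ?thesis
    by (intro definable_valueI[where f = "\<lambda>xs. g (f xs # drop n xs)" and N = "\<lambda>xs. N xs * (W xs + 1)"])
      (use f(4) g(2) in simp_all)
qed

text \<open>Residuals combine pointwise under any \<open>h\<close>, and the evaluator merely applies
  it. Conjunction, equality of letters and the successor modulo \<open>j\<close> are
  instances.\<close>

lemma definable_value_comp2:
  assumes h: "computable 2 (\<lambda>xs. h (xs ! 0) (xs ! 1))"
    and s: "definable_value n s" and t: "definable_value n t"
  shows "definable_value n (\<lambda>i e. h (s i e) (t i e))"
proof -
  obtain f N where f: "computable (n + m) f" "computable m N" "\<And>i. i \<in> V \<Longrightarrow> index_le k (s i) (N (ins i))"
      "\<And>i xs. i \<in> V \<Longrightarrow> length xs = n \<Longrightarrow> f (xs @ ins i) = s i (env xs)"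
    using s unfolding definable_value_def by blast
  obtain g M where g: "computable (n + m) g" "computable m M" "\<And>i. i \<in> V \<Longrightarrow> index_le k (t i) (M (ins i))"
      "\<And>i xs. i \<in> V \<Longrightarrow> length xs = n \<Longrightarrow> g (xs @ ins i) = t i (env xs)"
    using t unfolding definable_value_def by blast
  show ?thesis
    by (rule definable_valueI[where f = "\<lambda>xs. h (f xs) (g xs)" and N = "\<lambda>xs. N xs * M xs"])
      (use f g computable2[OF h f(1) g(1)] computable_mult[OF f(2) g(2)] in \<open>simp_all add: index_le_comp2\<close>)
qed

lemma definable_value_eq:
  assumes "definable_value n s" "definable_value n t"
  shows "definable n (\<lambda>i e. s i e = t i e)"
  unfolding definable_def
  by (rule definable_value_comp2[OF _ assms]) (auto intro!: computable_eq computable_nth)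

lemma definable_seq_eq:
  assumes "affine_term n s" "affine_term n t"
  shows "definable n (\<lambda>i e. seq i (s i e) = seq i (t i e))"
  using assms by (intro definable_value_eq definable_value_seq)

lemma definable_conj:
  assumes "definable n P" "definable n Q"
  shows "definable n (\<lambda>i e. P i e \<and> Q i e)"
  using definable_value_comp2[of "(*)", OF computable_mult[OF computable_nth computable_nth]]
    assms unfolding definable_def of_bool_conj by simp

lemma definable_not:
  assumes "definable n P"
  shows "definable n (\<lambda>i e. \<not> P i e)"
  using definable_value_eq[OF _ definable_value_param[OF computable_param_const[of 0]],
    of n "\<lambda>i e. of_bool (P i e)"] assms
  unfolding definable_def by simp

lemma definable_imp:
  assumes "definable n P" "definable n Q"
  shows "definable n (\<lambda>i e. P i e \<longrightarrow> Q i e)"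
  using definable_not[OF definable_conj[OF assms(1) definable_not[OF assms(2)]]] by simp

text \<open>Two facts about the matrix with bound \<open>N\<close> are combined:
  \<open>index_le_ex\<close> supplies the new bound \<open>2 ^ N\<close>, and
  \<open>bounded_witness\<close> makes the quantifier a finite search.\<close>

lemma definable_ex:
  assumes "definable (Suc n) (\<lambda>i e. P i (\<lambda>v. e (Suc v)) (e 0))"
  shows "definable n (\<lambda>i e. \<exists>x. P i e x)"
proof -
  define R where "R i e = P i (\<lambda>v. e (Suc v)) (e 0)" for i e
  have R: "R i (case_nat x e) = P i e x" for i x e by (simp add: R_def)
  obtain f N where f: "computable (Suc n + m) f" "computable m N"
      "\<And>i. i \<in> V \<Longrightarrow> index_le k (\<lambda>e. of_bool (R i e) :: nat) (N (ins i))"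
      "\<And>i xs. i \<in> V \<Longrightarrow> length xs = Suc n \<Longrightarrow> f (xs @ ins i) = of_bool (R i (env xs))"
    using assms unfolding definable_def definable_value_def R_def by blast
  have index: "index_le k (R i) (N (ins i))" if "i \<in> V" for i
    using index_le_comp[OF f(3)[OF that], of "\<lambda>b. b \<noteq> 0"] by simp
  \<comment> \<open>\<open>drop n zs\<close> is the input part. The sum also runs over the input
    entries, which only enlarges the search range.\<close>
  define F :: "nat list \<Rightarrow> nat"
    where "F zs = of_bool (\<exists>y < k ^ (N (drop n zs) + (\<Sum>j<n + m. zs ! j)). f (y # zs) = 1)" for zs
  have "computable (Suc (n + m)) (\<lambda>zs. f (hd zs # tl zs))"
    by (rule computable_cong[of _ f]) (use f(1) in \<open>auto simp: length_Suc_conv\<close>)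
  then have "computable (n + m) F"
    unfolding F_def using f(2)
    by (intro computable_bounded_ex computable_eq computable_power computable_add computable_const
      computable_drop computable_sum_entries)
  moreover have "computable m (\<lambda>xs. 2 ^ N xs)"
    by (intro computable_power computable_const f(2))
  moreover have "index_le k (\<lambda>e. of_bool (\<exists>x. P i e x) :: nat) (2 ^ N (ins i))" if "i \<in> V" for i
    using index_le_comp[OF index_le_ex[OF k_pos index[OF that]]] unfolding R .
  moreover have "F (xs @ ins i) = of_bool (\<exists>x. P i (env xs) x)" if i: "i \<in> V" and xs: "length xs = n" for i xs
  proof -
    let ?s = "\<Sum>j<n + m. (xs @ ins i) ! j"
    have "?s < k ^ ?s" using k_ge_2 by (metis less_exp power_mono less_le_trans zero_le_numeral)
    moreover have "env xs v \<le> ?s" for v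
    proof (cases "v < n")
      case True
      then have "(xs @ ins i) ! v \<le> ?s" by (intro member_le_sum) auto
      then show ?thesis using True xs by (simp add: env_def nth_append)
    qed (use xs in \<open>simp add: env_def\<close>)
    ultimately have small: "\<forall>v. env xs v < k ^ ?s" by (meson le_less_trans)
    have "F (xs @ ins i) = of_bool (\<exists>y < k ^ (N (ins i) + ?s). f (y # xs @ ins i) = 1)"
      unfolding F_def using xs by simp
    also have "\<dots> = of_bool (\<exists>y < k ^ (N (ins i) + ?s). R i (case_nat y (env xs)))"
      using f(4)[OF i, of "_ # xs"] xs by (auto simp: env_Cons)
    also have "\<dots> = of_bool (\<exists>y. R i (case_nat y (env xs)))"
      using bounded_witness[OF k_ge_2 index[OF i] small] by (intro arg_cong[of _ _ of_bool]) blast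
    finally show ?thesis unfolding R .
  qed
  ultimately show ?thesis
    unfolding definable_def
    by (rule definable_valueI)
qed

lemma definable_all:
  assumes "definable (Suc n) (\<lambda>i e. P i (\<lambda>v. e (Suc v)) (e 0))"
  shows "definable n (\<lambda>i e. \<forall>x. P i e x)"
  using definable_not[OF definable_ex[OF definable_not[OF assms]]] by simp

lemmas definable_intros = definable_ex definable_all definable_not definable_conj definable_imp
  definable_le definable_seq_eq affine_term_add affine_term_cmult affine_term_var affine_term_param
  computable_param_const

text \<open>Equivalence on valid inputs suffices, so characterizations that rely on
  \<open>r > 1\<close> or on a finite range can be used.\<close>

lemma definable_cong:
  assumes "definable n P" "\<And>i e. i \<in> V \<Longrightarrow> Q i e = P i e"
  shows "definable n Q"
proof -
  have eq: "Q i = P i" if "i \<in> V" for i using assms(2)[OF that] by blast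
  obtain f N where "computable (n + m) f" "computable m N" "\<forall>i\<in>V. index_le k (\<lambda>e. of_bool (P i e) :: nat) (N (ins i)) \<and>
      (\<forall>xs. length xs = n \<longrightarrow> f (xs @ ins i) = of_bool (P i (env xs)))"
    using assms(1) unfolding definable_def definable_value_def by blast
  then show ?thesis
    unfolding definable_def
    by (intro definable_valueI[where f = f and N = N])
      (simp_all add: eq)
qed

text \<open>Without free variables the argument list of the evaluator is just the input.\<close>

lemma definable_imp_computable:
  assumes "definable 0 (\<lambda>i e. P i)"
  shows "\<exists>f. computable m f \<and> (\<forall>i\<in>V. f (ins i) = of_bool (P i))"
  using assms unfolding definable_def definable_value_def by force

text \<open>Every value \<open>seq i x\<close> is the value at 0 of the residual that fixes
  \<open>x\<close> as remainder, and there are finitely many residuals.\<close>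

lemma finite_range_seq:
  assumes "i \<in> V"
  shows "finite (range (seq i))"
proof -
  have "range (seq i) \<subseteq> (\<lambda>b. b (\<lambda>_. 0)) ` kernel k (\<lambda>e. seq i (e 0))"
  proof clarify
    fix x
    have "x < k ^ x" using k_ge_2 by (metis less_exp power_mono less_le_trans zero_le_numeral)
    then have "(\<lambda>e. seq i (k ^ x * e 0 + x)) \<in> kernel k (\<lambda>e. seq i (e 0))"
      using kernelI[of "\<lambda>_. x" k x "\<lambda>e. seq i (e 0)"] by simp
    then show "seq i x \<in> (\<lambda>b. b (\<lambda>_. 0)) ` kernel k (\<lambda>e. seq i (e 0))"
      by (rule rev_image_eqI) simp
  qed
  moreover have "finite (kernel k (\<lambda>e. seq i (e 0)))"
    using ex_index assms unfolding index_le_def by blast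
  ultimately show ?thesis by (meson finite_imageI finite_subset)
qed
end

section \<open>Occurrences of powers and palindromes\<close>

text \<open>Replaces words by numbers, over which formulas can quantify: position, length of the
  period word, length of the factor.\<close>

definition occurs_at :: "('a list \<Rightarrow> 'a list \<Rightarrow> bool) \<Rightarrow> 'a word \<Rightarrow> nat \<Rightarrow> nat \<Rightarrow> nat \<Rightarrow> bool" where
  "occurs_at Q a i n L \<longleftrightarrow> (\<exists>x. length x = n \<and> Q x (a [i \<rightarrow> i + L]))"

lemma factor_iff: "factor z a \<longleftrightarrow> (\<exists>i L. z = a [i \<rightarrow> i + L])"
  unfolding factor_def by (metis le_add1 le_add_diff_inverse)

section \<open>Avoidance and infinitude of occurrences\<close>

lemma avoids_iff_occurs_at:
  "avoids (\<lambda>z. \<exists>x. length x \<ge> l \<and> Q x z) a \<longleftrightarrow> \<not> (\<exists>i n L. l \<le> n \<and> occurs_at Q a i n L)"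
  unfolding avoids_def factor_iff occurs_at_def by blast

text \<open>Only finitely many occurrences end before a given position.\<close>

lemma infinite_occurrences_iff:
  "infinite (occurrences (\<lambda>z. \<exists>x. Q x z) a) \<longleftrightarrow> (\<forall>B. \<exists>i n L. B \<le> i + L \<and> occurs_at Q a i n L)"
proof
  assume inf: "infinite (occurrences (\<lambda>z. \<exists>x. Q x z) a)"
  show "\<forall>B. \<exists>i n L. B \<le> i + L \<and> occurs_at Q a i n L"
  proof (rule ccontr)
    assume "\<not> ?thesis"
    then obtain B where B: "\<And>i n L. occurs_at Q a i n L \<Longrightarrow> i + L < B" by (meson not_le)
    have "occurrences (\<lambda>z. \<exists>x. Q x z) a \<subseteq> {..<B} \<times> {..<B}"
    proof clarify
      fix i j assume "(i, j) \<in> occurrences (\<lambda>z. \<exists>x. Q x z) a"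
      then have "i \<le> j" "\<exists>n. occurs_at Q a i n (j - i)"
        unfolding occurrences_def occurs_at_def by auto
      with B[of i _ "j - i"] show "i \<in> {..<B} \<and> j \<in> {..<B}" by force
    qed
    with inf show False by (meson finite_SigmaI finite_lessThan finite_subset)
  qed
next
  assume all: "\<forall>B. \<exists>i n L. B \<le> i + L \<and> occurs_at Q a i n L"
  have "infinite (snd ` occurrences (\<lambda>z. \<exists>x. Q x z) a)"
    unfolding infinite_nat_iff_unbounded_le
  proof
    fix B
    obtain i n L where "B \<le> i + L" "occurs_at Q a i n L" using all by blast
    then have "(i, i + L) \<in> occurrences (\<lambda>z. \<exists>x. Q x z) a"
      unfolding occurs_at_def occurrences_def by auto
    with \<open>B \<le> i + L\<close> show "\<exists>j\<ge>B. j \<in> snd ` occurrences (\<lambda>z. \<exists>x. Q x z) a" by force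
  qed
  then show "infinite (occurrences (\<lambda>z. \<exists>x. Q x z) a)" by blast
qed

text \<open>Over a finite alphabet there are finitely many words of bounded length, so distinct
  factors can be counted through their lengths alone.\<close>

lemma infinite_factors_iff:
  assumes "finite (range a)"
  shows "infinite {z. factor z a \<and> (\<exists>x. Q x z)} \<longleftrightarrow> (\<forall>B. \<exists>i n L. B \<le> L \<and> occurs_at Q a i n L)"
proof
  assume inf: "infinite {z. factor z a \<and> (\<exists>x. Q x z)}"
  show "\<forall>B. \<exists>i n L. B \<le> L \<and> occurs_at Q a i n L"
  proof (rule ccontr)
    assume "\<not> ?thesis"
    then obtain B where B: "\<And>i n L. occurs_at Q a i n L \<Longrightarrow> L < B" by (meson not_le)
    have "{z. factor z a \<and> (\<exists>x. Q x z)} \<subseteq> {z. set z \<subseteq> range a \<and> length z \<le> B}"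
    proof clarify
      fix z x assume "factor z a" "Q x z"
      then obtain i L where z: "z = a [i \<rightarrow> i + L]" "occurs_at Q a i (length x) L"
        unfolding factor_iff occurs_at_def by blast
      then show "set z \<subseteq> range a \<and> length z \<le> B" using B[OF z(2)] by auto
    qed
    with inf show False using finite_lists_length_le[OF assms] finite_subset by blast
  qed
next
  assume all: "\<forall>B. \<exists>i n L. B \<le> L \<and> occurs_at Q a i n L"
  have "infinite (length ` {z. factor z a \<and> (\<exists>x. Q x z)})"
    unfolding infinite_nat_iff_unbounded_le
  proof
    fix B
    obtain i n L where "B \<le> L" "occurs_at Q a i n L" using all by blast
    then have "B \<le> length (a [i \<rightarrow> i + L])" "a [i \<rightarrow> i + L] \<in> {z. factor z a \<and> (\<exists>x. Q x z)}"
      unfolding occurs_at_def factor_iff by auto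
    then show "\<exists>j\<ge>B. j \<in> length ` {z. factor z a \<and> (\<exists>x. Q x z)}" by blast
  qed
  then show "infinite {z. factor z a \<and> (\<exists>x. Q x z)}" by blast
qed

lemma avoids_long_iff_occurs_at:
  "(\<exists>B. \<forall>x. length x \<ge> B \<longrightarrow> avoids (Q x) a) \<longleftrightarrow> (\<exists>B. \<not> (\<exists>i n L. B \<le> n \<and> occurs_at Q a i n L))"
  unfolding avoids_def factor_iff occurs_at_def by blast

section \<open>Powers as factors with a period\<close>

lemma subsequence_eq_iff:
  "a [i \<rightarrow> i + L] = w \<longleftrightarrow> length w = L \<and> (\<forall>t<L. a (i + t) = w ! t)"
  by (auto simp: list_eq_iff_nth_eq)

text \<open>As \<open>n \<le> L\<close>, the period word must be the first \<open>n\<close> letters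
  of the factor. Writing \<open>t + n + 1 \<le> L\<close> for a strict inequality suits
  \<open>definable_le\<close>.\<close>

lemma period_iff:
  assumes "1 \<le> n" "n \<le> L"
  shows "(\<exists>x. length x = n \<and> a [i \<rightarrow> i + L] = prefix L (x\<^sup>\<omega>)) \<longleftrightarrow>
    (\<forall>t. t + n + 1 \<le> L \<longrightarrow> a (i + t) = a (i + t + n))"
proof
  assume "\<exists>x. length x = n \<and> a [i \<rightarrow> i + L] = prefix L (x\<^sup>\<omega>)"
  then obtain x where x: "length x = n" "\<forall>t<L. a (i + t) = x ! (t mod n)"
    using assms by (auto simp: subsequence_eq_iff Suc_le_eq)
  show "\<forall>t. t + n + 1 \<le> L \<longrightarrow> a (i + t) = a (i + t + n)"
  proof clarify
    fix t assume "t + n + 1 \<le> L"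
    then show "a (i + t) = a (i + t + n)"
      using spec[OF x(2), of t] spec[OF x(2), of "t + n"] by (simp add: add.assoc)
  qed
next
  assume per: "\<forall>t. t + n + 1 \<le> L \<longrightarrow> a (i + t) = a (i + t + n)"
  \<comment> \<open>Repeated subtraction of \<open>n\<close> moves every position into the first
    block without leaving the factor.\<close>
  have "a (i + t) = a (i + t mod n)" if "t < L" for t
    using that
  proof (induction t rule: less_induct)
    case (less t)
    show ?case
    proof (cases "t < n")
      case False
      then have "a (i + (t - n)) = a (i + t)" using per[rule_format, of "t - n"] less.prems by simp
      then show ?thesis using less.IH[of "t - n"] less.prems False assms by (simp add: le_mod_geq)
    qed simp
  qed
  then show "\<exists>x. length x = n \<and> a [i \<rightarrow> i + L] = prefix L (x\<^sup>\<omega>)"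
    using assms by (intro exI[of _ "a [i \<rightarrow> i + n]"]) (auto simp: subsequence_eq_iff)
qed

lemma Least_eq_iff:
  assumes "\<exists>m. P m"
  shows "(LEAST m. P m) = (L :: nat) \<longleftrightarrow> P L \<and> (\<forall>m<L. \<not> P m)"
  using assms by (metis LeastI_ex Least_equality not_less not_less_Least)

text \<open>The two inequalities say that \<open>L\<close> is the length of the power of a word of length \<open>n\<close>. They
  differ from those for \<open>plus_power_of\<close> only in the summand \<open>0\<close>, which is \<open>1\<close> there.\<close>

lemma occurs_at_power_of:
  fixes p q :: nat
  assumes pq: "0 < q" "q < p"
  shows "occurs_at (power_of (real p / real q)) a i n L \<longleftrightarrow>
    1 \<le> n \<and> p * n + 0 \<le> q * L \<and> q * L + 1 \<le> p * n + q + 0 \<and>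
    (\<forall>t. t + n + 1 \<le> L \<longrightarrow> a (i + t) = a (i + t + n))"
proof -
  have ge: "real p / real q * real n \<le> real m \<longleftrightarrow> p * n \<le> q * m" for m
  proof -
    have "real p / real q * real n \<le> real m \<longleftrightarrow> real (p * n) \<le> real (q * m)"
      using pq by (simp add: field_simps)
    then show ?thesis by (simp only: of_nat_le_iff)
  qed
  have Least: "(LEAST m. real p / real q * real n \<le> real m) = L \<longleftrightarrow> p * n \<le> q * L \<and> q * L + 1 \<le> p * n + q"
    if "1 \<le> n"
  proof -
    have ex: "\<exists>m. p * n \<le> q * m" using pq by (intro exI[of _ "p * n"]) simp
    have "(LEAST m. p * n \<le> q * m) = L \<longleftrightarrow> p * n \<le> q * L \<and> (\<forall>m<L. q * m < p * n)"
      unfolding Least_eq_iff[OF ex] by (simp add: not_le)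
    also have "\<dots> \<longleftrightarrow> p * n \<le> q * L \<and> q * L + 1 \<le> p * n + q"
    proof (cases L)
      case 0
      then show ?thesis using that pq by auto
    next
      case (Suc L')
      \<comment> \<open>Since \<open>q * m\<close> grows with \<open>m\<close>, minimality of
        \<open>L\<close> is tested at its predecessor alone, which gives the second
        inequality.\<close>
      have "(\<forall>m<L. q * m < p * n) \<longleftrightarrow> q * L' < p * n"
        using Suc by (meson le_less_trans less_Suc_eq_le mult_le_mono2 order_refl)
      then show ?thesis using Suc by auto
    qed
    finally show ?thesis unfolding ge .
  qed
  \<comment> \<open>An exponent above 1 makes the power at least as long as its period word, as
    \<open>period_iff\<close> presupposes.\<close>
  have "n \<le> L" if "p * n \<le> q * L"
  proof -
    have "q * n \<le> q * L" using pq that by (meson le_trans less_imp_le mult_le_mono1)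
    then show ?thesis using pq by simp
  qed
  moreover have "occurs_at (power_of (real p / real q)) a i n L \<longleftrightarrow> 1 \<le> n \<and>
      (LEAST m. real p / real q * real n \<le> real m) = L \<and> (\<exists>x. length x = n \<and> a [i \<rightarrow> i + L] = prefix L (x\<^sup>\<omega>))"
    unfolding occurs_at_def power_of_def
    by (auto simp: Suc_le_eq) (metis subsequence_length add_diff_cancel_left' diff_zero)+
  ultimately show ?thesis using Least period_iff[of n L a i] by auto
qed

lemma occurs_at_plus_power_of:
  fixes p q :: nat
  assumes pq: "0 < q" "q < p"
  shows "occurs_at (plus_power_of (real p / real q)) a i n L \<longleftrightarrow>
    1 \<le> n \<and> p * n + 1 \<le> q * L \<and> q * L + 1 \<le> p * n + q + 1 \<and>
    (\<forall>t. t + n + 1 \<le> L \<longrightarrow> a (i + t) = a (i + t + n))"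
proof -
  have gr: "real p / real q * real n < real m \<longleftrightarrow> p * n < q * m" for m
  proof -
    have "real p / real q * real n < real m \<longleftrightarrow> real (p * n) < real (q * m)"
      using pq by (simp add: field_simps)
    then show ?thesis by (simp only: of_nat_less_iff)
  qed
  have Least: "(LEAST m. real p / real q * real n < real m) = L \<longleftrightarrow> p * n + 1 \<le> q * L \<and> q * L + 1 \<le> p * n + q + 1"
    if "1 \<le> n"
  proof -
    have "p * n < q * Suc (p * n)" using pq by (cases q) auto
    then have ex: "\<exists>m. p * n < q * m" by blast
    have "(LEAST m. p * n < q * m) = L \<longleftrightarrow> p * n < q * L \<and> (\<forall>m<L. q * m \<le> p * n)"
      unfolding Least_eq_iff[OF ex] by (simp add: not_less)
    also have "\<dots> \<longleftrightarrow> p * n + 1 \<le> q * L \<and> q * L + 1 \<le> p * n + q + 1"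
    proof (cases L)
      case 0
      then show ?thesis by auto
    next
      case (Suc L')
      have "(\<forall>m<L. q * m \<le> p * n) \<longleftrightarrow> q * L' \<le> p * n"
        using Suc by (meson le_trans less_Suc_eq_le mult_le_mono2 order_refl)
      then show ?thesis using Suc by auto
    qed
    finally show ?thesis unfolding gr .
  qed
  have "n \<le> L" if "p * n + 1 \<le> q * L"
  proof -
    have "q * n \<le> p * n" using pq by simp
    then have "q * n \<le> q * L" using that by linarith
    then show ?thesis using pq by simp
  qed
  moreover have "occurs_at (plus_power_of (real p / real q)) a i n L \<longleftrightarrow> 1 \<le> n \<and>
      (LEAST m. real p / real q * real n < real m) = L \<and> (\<exists>x. length x = n \<and> a [i \<rightarrow> i + L] = prefix L (x\<^sup>\<omega>))"
    unfolding occurs_at_def plus_power_of_def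
    by (auto simp: Suc_le_eq) (metis subsequence_length add_diff_cancel_left' diff_zero)+
  ultimately show ?thesis using Least period_iff[of n L a i] by auto
qed

section \<open>Reversals and shifted squares\<close>

text \<open>Mirrored offsets satisfy \<open>s + t + 1 = L\<close>. Truncated subtraction is not
  affine, so the equation is kept additive and split into two inequalities.\<close>

lemma rev_factor_iff:
  "rev (a [i \<rightarrow> i + L]) = a [j \<rightarrow> j + L] \<longleftrightarrow>
    (\<forall>s t. L \<le> s + t + 1 \<and> s + t + 1 \<le> L \<longrightarrow> a (i + s) = a (j + t))"
proof -
  have "rev (a [i \<rightarrow> i + L]) = a [j \<rightarrow> j + L] \<longleftrightarrow> (\<forall>t<L. a (i + (L - Suc t)) = a (j + t))"
    by (auto simp: list_eq_iff_nth_eq rev_nth)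
  also have "\<dots> \<longleftrightarrow> (\<forall>s t. L \<le> s + t + 1 \<and> s + t + 1 \<le> L \<longrightarrow> a (i + s) = a (j + t))"
  proof safe
    fix s t assume "\<forall>t<L. a (i + (L - Suc t)) = a (j + t)" "L \<le> s + t + 1" "s + t + 1 \<le> L"
    moreover from this have "L - Suc t = s" "t < L" by auto
    ultimately show "a (i + s) = a (j + t)" by metis
  next
    fix t assume *: "\<forall>s t. L \<le> s + t + 1 \<and> s + t + 1 \<le> L \<longrightarrow> a (i + s) = a (j + t)" and "t < L"
    then show "a (i + (L - Suc t)) = a (j + t)" using *[rule_format, of "L - Suc t" t] by simp
  qed
  finally show ?thesis .
qed

text \<open>A palindrome is the case \<open>j = i\<close> of \<open>rev_factor_iff\<close>.\<close>

lemma avoids_palindromes_iff: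
  "avoids (\<lambda>z. palindrome z \<and> length z \<ge> l) a \<longleftrightarrow>
    \<not> (\<exists>i L. l \<le> L \<and> (\<forall>s t. L \<le> s + t + 1 \<and> s + t + 1 \<le> L \<longrightarrow> a (i + s) = a (i + t)))"
  unfolding avoids_def factor_iff palindrome_def rev_factor_iff[symmetric] by auto

lemma reversal_free_iff:
  "(\<forall>x. factor x a \<and> length x \<ge> l \<longrightarrow> \<not> factor (rev x) a) \<longleftrightarrow>
    \<not> (\<exists>i j L. l \<le> L \<and> (\<forall>s t. L \<le> s + t + 1 \<and> s + t + 1 \<le> L \<longrightarrow> a (i + s) = a (j + t)))"
proof -
  have "factor (rev (a [i \<rightarrow> i + L])) a \<longleftrightarrow> (\<exists>j. rev (a [i \<rightarrow> i + L]) = a [j \<rightarrow> j + L])" for i L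
    unfolding factor_iff by (metis add_diff_cancel_left' length_rev subsequence_length)
  moreover have "(\<forall>x. factor x a \<and> length x \<ge> l \<longrightarrow> \<not> factor (rev x) a) \<longleftrightarrow>
      (\<forall>i L. l \<le> L \<longrightarrow> \<not> factor (rev (a [i \<rightarrow> i + L])) a)"
    by (metis add_diff_cancel_left' factor_iff subsequence_length)
  ultimately show ?thesis
    unfolding rev_factor_iff[symmetric] by blast
qed

lemma avoids_shifted_squares_iff:
  "avoids (\<lambda>z. \<exists>x. x \<noteq> [] \<and> z = x @ map (\<lambda>c. (c + 1) mod j) x) a \<longleftrightarrow>
    \<not> (\<exists>i n. 1 \<le> n \<and> (\<forall>t. t + 1 \<le> n \<longrightarrow> a (i + n + t) = (a (i + t) + 1) mod j))"
proof -
  have "(\<exists>L x. x \<noteq> [] \<and> a [i \<rightarrow> i + L] = x @ map (\<lambda>c. (c + 1) mod j) x) \<longleftrightarrow>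
    (\<exists>n. 1 \<le> n \<and> (\<forall>t. t + 1 \<le> n \<longrightarrow> a (i + n + t) = (a (i + t) + 1) mod j))" for i
  proof
    assume "\<exists>L x. x \<noteq> [] \<and> a [i \<rightarrow> i + L] = x @ map (\<lambda>c. (c + 1) mod j) x"
    then obtain L x where x: "x \<noteq> []" "a [i \<rightarrow> i + L] = x @ map (\<lambda>c. (c + 1) mod j) x" by blast
    then have L: "L = length x + length x"
      and nth: "\<And>t. t < L \<Longrightarrow> a (i + t) = (x @ map (\<lambda>c. (c + 1) mod j) x) ! t"
      unfolding subsequence_eq_iff by auto
    have "a (i + length x + t) = (a (i + t) + 1) mod j" if "t + 1 \<le> length x" for t
      using nth[of t] nth[of "length x + t"] that L by (simp add: nth_append add.assoc)
    then show "\<exists>n. 1 \<le> n \<and> (\<forall>t. t + 1 \<le> n \<longrightarrow> a (i + n + t) = (a (i + t) + 1) mod j)"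
      using x(1) by (intro exI[of _ "length x"]) (auto simp: Suc_le_eq)
  next
    assume "\<exists>n. 1 \<le> n \<and> (\<forall>t. t + 1 \<le> n \<longrightarrow> a (i + n + t) = (a (i + t) + 1) mod j)"
    then obtain n where n: "1 \<le> n" "\<And>t. t + 1 \<le> n \<Longrightarrow> a (i + n + t) = (a (i + t) + 1) mod j" by blast
    let ?x = "a [i \<rightarrow> i + n]"
    have "a (i + t) = (?x @ map (\<lambda>c. (c + 1) mod j) ?x) ! t" if "t < n + n" for t
      using n(2)[of "t - n"] that by (auto simp: nth_append not_less)
    then have "a [i \<rightarrow> i + (n + n)] = ?x @ map (\<lambda>c. (c + 1) mod j) ?x"
      unfolding subsequence_eq_iff by simp
    moreover have "?x \<noteq> []" using n(1) by simp
    ultimately show "\<exists>L x. x \<noteq> [] \<and> a [i \<rightarrow> i + L] = x @ map (\<lambda>c. (c + 1) mod j) x" by blast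
  qed
  then show ?thesis unfolding avoids_def factor_iff by metis
qed

section \<open>Decision procedures\<close>

context input_family
begin

lemma definable_avoids_palindromes:
  assumes "computable_param l"
  shows "definable 0 (\<lambda>i e. avoids (\<lambda>z. palindrome z \<and> length z \<ge> l i) (seq i))"
  unfolding avoids_palindromes_iff by (intro definable_intros assms) auto

lemma definable_avoids_long_palindromes:
  "definable 0 (\<lambda>i e. \<exists>L. avoids (\<lambda>z. palindrome z \<and> length z \<ge> L) (seq i))"
  unfolding avoids_palindromes_iff by (intro definable_intros) auto

lemma definable_reversal_free:
  assumes "computable_param l"
  shows "definable 0 (\<lambda>i e. \<forall>x. factor x (seq i) \<and> length x \<ge> l i \<longrightarrow> \<not> factor (rev x) (seq i))"
  unfolding reversal_free_iff by (intro definable_intros assms) auto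

lemma definable_avoids_shifted_squares:
  assumes "computable_param j"
  shows "definable 0 (\<lambda>i e. avoids (\<lambda>z. \<exists>x. x \<noteq> [] \<and> z = x @ map (\<lambda>c. (c + 1) mod j i) x) (seq i))"
proof -
  have h: "computable 2 (\<lambda>xs. (xs ! 0 + 1) mod xs ! 1)"
    by (auto intro!: computable_mod computable_Suc computable_nth)
  \<comment> \<open>One side is not a bare letter of the sequence, so
    \<open>definable_seq_eq\<close> does not apply and the successor modulo \<open>j\<close> is
    composed explicitly.\<close>
  have eq: "definable n (\<lambda>i e. seq i (s i e) = (seq i (t i e) + 1) mod j i)"
    if "affine_term n s" "affine_term n t" for n s t
    by (intro definable_value_eq definable_value_comp2[OF h] definable_value_seq definable_value_param
      that assms)
  show ?thesis
    unfolding avoids_shifted_squares_iff by (intro eq definable_intros) auto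
qed

end

text \<open>Treats both kinds of powers at once: \<open>p j / q j\<close> is the exponent, and
  \<open>c\<close> distinguishes the kinds.\<close>

locale power_family = input_family k V ins m seq
  for k and V :: "'i set" and ins m seq +
  fixes p q :: "'i \<Rightarrow> nat" and Q :: "'i \<Rightarrow> nat list \<Rightarrow> nat list \<Rightarrow> bool" and c :: nat
  assumes computable_p: "computable_param p" and computable_q: "computable_param q"
    and occurs_at_Q: "j \<in> V \<Longrightarrow> occurs_at (Q j) (seq j) i n L \<longleftrightarrow>
      1 \<le> n \<and> p j * n + c \<le> q j * L \<and> q j * L + 1 \<le> p j * n + q j + c \<and>
      (\<forall>t. t + n + 1 \<le> L \<longrightarrow> seq j (i + t) = seq j (i + t + n))"
begin

lemma definable_occurs_at:
  assumes "affine_term n x" "affine_term n y" "affine_term n z"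
  shows "definable n (\<lambda>i e. occurs_at (Q i) (seq i) (x i e) (y i e) (z i e))"
proof (rule definable_cong[OF _ occurs_at_Q])
  show "definable n (\<lambda>i e. 1 \<le> y i e \<and> p i * y i e + c \<le> q i * z i e \<and>
      q i * z i e + 1 \<le> p i * y i e + q i + c \<and>
      (\<forall>t. t + y i e + 1 \<le> z i e \<longrightarrow> seq i (x i e + t) = seq i (x i e + t + y i e)))"
    by (intro assms[THEN affine_term_Suc] assms computable_p computable_q definable_intros) auto
qed

lemma definable_avoids_powers:
  assumes "computable_param l"
  shows "definable 0 (\<lambda>i e. avoids (\<lambda>z. \<exists>x. length x \<ge> l i \<and> Q i x z) (seq i))"
  unfolding avoids_iff_occurs_at by (intro definable_occurs_at definable_intros assms) auto

lemma definable_infinite_occurrences: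
  "definable 0 (\<lambda>i e. infinite (occurrences (\<lambda>z. \<exists>x. Q i x z) (seq i)))"
  unfolding infinite_occurrences_iff by (intro definable_occurs_at definable_intros) auto

lemma definable_infinite_factors:
  "definable 0 (\<lambda>i e. infinite {z. factor z (seq i) \<and> (\<exists>x. Q i x z)})"
proof (rule definable_cong[OF _ infinite_factors_iff[OF finite_range_seq]])
  show "definable 0 (\<lambda>i e. \<forall>B. \<exists>x n L. B \<le> L \<and> occurs_at (Q i) (seq i) x n L)"
    by (intro definable_occurs_at definable_intros) auto
qed

lemma definable_avoids_long_powers:
  "definable 0 (\<lambda>i e. \<exists>B. \<forall>x. length x \<ge> B \<longrightarrow> avoids (Q i x) (seq i))"
  unfolding avoids_long_iff_occurs_at by (intro definable_occurs_at definable_intros) auto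

end

section \<open>Automata with parameters as inputs\<close>

definition dfao_inputs ::
  "nat \<Rightarrow> ('p \<Rightarrow> nat word \<Rightarrow> bool) \<Rightarrow> ((nat, nat) dfao \<times> nat word \<times> 'p) set" where
  "dfao_inputs k A = {(M, a, p). is_dfao k M \<and> numbered M \<and> generates k M a \<and> A p a}"

definition dfao_input_code :: "nat \<Rightarrow> ('p \<Rightarrow> nat list) \<Rightarrow> (nat, nat) dfao \<times> nat word \<times> 'p \<Rightarrow> nat list" where
  "dfao_input_code k enc = (\<lambda>(M, a, p). dfao_code k M # enc p)"

lemma input_family_dfao:
  assumes "k \<ge> 2" "\<And>p a. A p a \<Longrightarrow> length (enc p) = n"
  shows "input_family k (dfao_inputs k A) (dfao_input_code k enc) (Suc n) (\<lambda>i. fst (snd i))"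
proof
  show "\<exists>f. computable (Suc (Suc n)) f \<and>
      (\<forall>i\<in>dfao_inputs k A. \<forall>x. f (x # dfao_input_code k enc i) = fst (snd i) x)"
    by (rule exI[of _ "\<lambda>xs. eval_code k (xs ! 1) (xs ! 0)"])
      (auto simp: dfao_inputs_def dfao_input_code_def eval_code assms(1)
        intro!: computable_eval_code computable_nth)
  show "\<exists>N. computable (Suc n) N \<and> (\<forall>i\<in>dfao_inputs k A.
      index_le k (\<lambda>e. fst (snd i) (e 0)) (N (dfao_input_code k enc i)))"
    by (rule exI[of _ "\<lambda>xs. encoded_nth (xs ! 0) 0"])
      (auto simp: dfao_inputs_def dfao_input_code_def encoded_nth_dfao_code
        intro!: computable_encoded_nth computable_const computable_nth index_le_automatic assms(1))
qed (use assms in \<open>auto simp: dfao_inputs_def dfao_input_code_def\<close>)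

lemma decidable_if_definable:
  assumes family: "input_family k (dfao_inputs k A) (dfao_input_code k enc) (Suc n) (\<lambda>i. fst (snd i))"
    and enc: "\<And>p a. A p a \<Longrightarrow> length (enc p) = n"
    and P: "input_family.definable k (dfao_inputs k A) (dfao_input_code k enc) (Suc n) 0
      (\<lambda>i e. P (snd (snd i)) (fst (snd i)))"
  shows "decidable_for_dfaos k enc A P"
proof -
  interpret input_family k "dfao_inputs k A" "dfao_input_code k enc" "Suc n" "\<lambda>i. fst (snd i)"
    by (rule family)
  obtain f where "computable (Suc n) f"
      "\<forall>i\<in>dfao_inputs k A. f (dfao_input_code k enc i) = of_bool (P (snd (snd i)) (fst (snd i)))"
    using definable_imp_computable[OF P] by blast
  then obtain g where g: "recursive (Suc n) g" and
      "\<forall>i\<in>dfao_inputs k A. g (dfao_input_code k enc i) = of_bool (P (snd (snd i)) (fst (snd i)))"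
    unfolding computable_def using length_ins by metis
  then have "g (dfao_code k M # enc p) = (if P p a then 1 else 0)"
    if "is_dfao k M \<and> numbered M \<and> generates k M a \<and> A p a" for M a p
    using that by (force simp: dfao_inputs_def dfao_input_code_def)
  then show ?thesis unfolding decidable_for_dfaos_def using g enc by blast
qed

lemma computable_param_dfao:
  assumes family: "input_family k (dfao_inputs k A) (dfao_input_code k enc) (Suc n) (\<lambda>i. fst (snd i))"
    and "j < n" "\<And>p. enc p ! j = c p"
  shows "input_family.computable_param (dfao_inputs k A) (dfao_input_code k enc) (Suc n)
    (\<lambda>i. c (snd (snd i)))"
proof -
  interpret input_family k "dfao_inputs k A" "dfao_input_code k enc" "Suc n" "\<lambda>i. fst (snd i)"
    by (rule family)
  show ?thesis
    unfolding computable_param_def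
    by (rule exI[of _ "\<lambda>xs. xs ! Suc j"])
      (use assms(2,3) in \<open>auto simp: dfao_input_code_def intro!: computable_nth\<close>)
qed

definition numerator :: "rat \<Rightarrow> nat" where
  "numerator r = nat (fst (quotient_of r))"

definition denominator :: "rat \<Rightarrow> nat" where
  "denominator r = nat (snd (quotient_of r))"

lemma rat_code_eq: "rat_code r = [numerator r, denominator r]"
  by (simp add: rat_code_def numerator_def denominator_def case_prod_unfold)

lemma numerator_denominator:
  assumes "r > 1"
  shows "0 < denominator r" "denominator r < numerator r"
    "of_rat r = real (numerator r) / real (denominator r)"
proof -
  obtain p q where pq: "quotient_of r = (p, q)" by (cases "quotient_of r")
  have q: "q > 0" using quotient_of_denom_pos[OF pq] .
  have r: "r = of_int p / of_int q" using quotient_of_div[OF pq] .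
  have "1 < of_int p / (of_int q :: rat)" using assms r by simp
  then have "(of_int q :: rat) < of_int p" using q by (simp add: less_divide_eq)
  then have p: "q < p" by simp
  show "0 < denominator r" "denominator r < numerator r"
    using pq p q by (simp_all add: numerator_def denominator_def)
  have "of_rat r = (of_int p / of_int q :: real)" by (simp add: r of_rat_divide)
  then show "of_rat r = real (numerator r) / real (denominator r)"
    using pq p q by (simp add: numerator_def denominator_def)
qed

text \<open>\<open>rest\<close> leaves room for parameters after the rational number, such as a
  length.\<close>

lemma power_family_dfao:
  fixes \<rho> :: "'p \<Rightarrow> rat"
  assumes family: "input_family k (dfao_inputs k A) (dfao_input_code k enc) (Suc n) (\<lambda>i. fst (snd i))"
    and enc: "\<And>p. enc p = rat_code (\<rho> p) @ rest p" and n: "2 \<le> n"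
    and A: "\<And>p a. A p a \<Longrightarrow> 1 < \<rho> p"
    and Q: "\<And>p q (a :: nat word) i n L. 0 < q \<Longrightarrow> q < p \<Longrightarrow> occurs_at (Q (real p / real q)) a i n L \<longleftrightarrow>
      1 \<le> n \<and> p * n + c \<le> q * L \<and> q * L + 1 \<le> p * n + q + c \<and>
      (\<forall>t. t + n + 1 \<le> L \<longrightarrow> a (i + t) = a (i + t + n))"
  shows "power_family k (dfao_inputs k A) (dfao_input_code k enc) (Suc n) (\<lambda>i. fst (snd i))
      (\<lambda>i. numerator (\<rho> (snd (snd i)))) (\<lambda>i. denominator (\<rho> (snd (snd i))))
      (\<lambda>i. Q (of_rat (\<rho> (snd (snd i))))) c"
proof -
  interpret input_family k "dfao_inputs k A" "dfao_input_code k enc" "Suc n" "\<lambda>i. fst (snd i)"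
    by (rule family)
  show ?thesis
  proof unfold_locales
    show "computable_param (\<lambda>i. numerator (\<rho> (snd (snd i))))"
      by (rule computable_param_dfao[OF family, of 0]) (use n in \<open>auto simp: enc rat_code_eq\<close>)
    show "computable_param (\<lambda>i. denominator (\<rho> (snd (snd i))))"
      by (rule computable_param_dfao[OF family, of 1]) (use n in \<open>auto simp: enc rat_code_eq\<close>)
  next
    fix j :: "(nat, nat) dfao \<times> nat word \<times> 'p" and i l L :: nat
    assume "j \<in> dfao_inputs k A"
    then have "1 < \<rho> (snd (snd j))" using A by (auto simp: dfao_inputs_def)
    note r = numerator_denominator[OF this]
    show "occurs_at (Q (of_rat (\<rho> (snd (snd j))))) (fst (snd j)) i l L \<longleftrightarrow>
      1 \<le> l \<and> numerator (\<rho> (snd (snd j))) * l + c \<le> denominator (\<rho> (snd (snd j))) * L \<and>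
      denominator (\<rho> (snd (snd j))) * L + 1 \<le> numerator (\<rho> (snd (snd j))) * l + denominator (\<rho> (snd (snd j))) + c \<and>
      (\<forall>t. t + l + 1 \<le> L \<longrightarrow> fst (snd j) (i + t) = fst (snd j) (i + t + l))"
      unfolding r(3) by (rule Q[OF r(1,2)])
  qed
qed

lemma decidable_powers:
  fixes Q :: "real \<Rightarrow> nat list \<Rightarrow> nat list \<Rightarrow> bool"
  assumes k: "k \<ge> 2"
    and Q: "\<And>p q (a :: nat word) i n L. 0 < q \<Longrightarrow> q < p \<Longrightarrow> occurs_at (Q (real p / real q)) a i n L \<longleftrightarrow>
      1 \<le> n \<and> p * n + c \<le> q * L \<and> q * L + 1 \<le> p * n + q + c \<and>
      (\<forall>t. t + n + 1 \<le> L \<longrightarrow> a (i + t) = a (i + t + n))"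
  shows "decidable_for_dfaos k rat_code (\<lambda>r a. r > 1) (\<lambda>r a. avoids (\<lambda>z. \<exists>x. Q (of_rat r) x z) a)"
    and "decidable_for_dfaos k rat_code (\<lambda>r a. r > 1)
      (\<lambda>r a. infinite (occurrences (\<lambda>z. \<exists>x. Q (of_rat r) x z) a))"
    and "decidable_for_dfaos k rat_code (\<lambda>r a. r > 1)
      (\<lambda>r a. infinite {z. factor z a \<and> (\<exists>x. Q (of_rat r) x z)})"
    and "decidable_for_dfaos k rat_code (\<lambda>r a. r > 1)
      (\<lambda>r a. \<exists>L. \<forall>x. length x \<ge> L \<longrightarrow> avoids (Q (of_rat r) x) a)"
    and "decidable_for_dfaos k (\<lambda>(r, l). rat_code r @ [l]) (\<lambda>(r, l) a. r > 1)
      (\<lambda>(r, l) a. avoids (\<lambda>z. \<exists>x. length x \<ge> l \<and> Q (of_rat r) x z) a)"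
proof -
  let ?A = "\<lambda>r (a :: nat word). (r :: rat) > 1"
  have len: "length (rat_code r) = 2" for r by (simp add: rat_code_eq)
  have family: "input_family k (dfao_inputs k ?A) (dfao_input_code k rat_code) (Suc 2) (\<lambda>i. fst (snd i))"
    by (rule input_family_dfao[OF k len])
  interpret power_family k "dfao_inputs k ?A" "dfao_input_code k rat_code" "Suc 2" "\<lambda>i. fst (snd i)"
    "\<lambda>i. numerator (snd (snd i))" "\<lambda>i. denominator (snd (snd i))" "\<lambda>i. Q (of_rat (snd (snd i)))" c
    by (rule power_family_dfao[OF family, of "\<lambda>r. r" "\<lambda>_. []"]) (simp_all add: Q)
  note decidable = decidable_if_definable[OF family len]
  \<comment> \<open>Plain avoidance is avoidance with minimal period length 0.\<close>
  show "decidable_for_dfaos k rat_code ?A (\<lambda>r a. avoids (\<lambda>z. \<exists>x. Q (of_rat r) x z) a)"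
    using definable_avoids_powers[OF computable_param_const[of 0]] by (intro decidable) simp
  show "decidable_for_dfaos k rat_code ?A (\<lambda>r a. infinite (occurrences (\<lambda>z. \<exists>x. Q (of_rat r) x z) a))"
    by (rule decidable) (rule definable_infinite_occurrences)
  show "decidable_for_dfaos k rat_code ?A (\<lambda>r a. infinite {z. factor z a \<and> (\<exists>x. Q (of_rat r) x z)})"
    by (rule decidable) (rule definable_infinite_factors)
  show "decidable_for_dfaos k rat_code ?A (\<lambda>r a. \<exists>L. \<forall>x. length x \<ge> L \<longrightarrow> avoids (Q (of_rat r) x) a)"
    by (rule decidable) (rule definable_avoids_long_powers)
next
  \<comment> \<open>A rational with a length is a different kind of input, hence a second
    interpretation of the locale.\<close>
  let ?A = "\<lambda>(r, l) (a :: nat word). (r :: rat) > 1" and ?enc = "\<lambda>(r, l). rat_code r @ [l]"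
  have len: "length (?enc x) = 3" for x by (simp add: rat_code_eq case_prod_unfold)
  have family: "input_family k (dfao_inputs k ?A) (dfao_input_code k ?enc) (Suc 3) (\<lambda>i. fst (snd i))"
    by (rule input_family_dfao[OF k len])
  interpret power_family k "dfao_inputs k ?A" "dfao_input_code k ?enc" "Suc 3" "\<lambda>i. fst (snd i)"
    "\<lambda>i. numerator (fst (snd (snd i)))" "\<lambda>i. denominator (fst (snd (snd i)))"
    "\<lambda>i. Q (of_rat (fst (snd (snd i))))" c
    by (rule power_family_dfao[OF family, of fst "\<lambda>x. [snd x]"]) (auto simp: Q)
  have "computable_param (\<lambda>i. snd (snd (snd i)))"
    by (rule computable_param_dfao[OF family, of 2]) (auto simp: rat_code_eq)
  from definable_avoids_powers[OF this]
  show "decidable_for_dfaos k ?enc ?A (\<lambda>(r, l) a. avoids (\<lambda>z. \<exists>x. length x \<ge> l \<and> Q (of_rat r) x z) a)"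
    by (intro decidable_if_definable[OF family len]) (simp add: case_prod_unfold)
qed

lemma decidable_with_length_param:
  assumes k: "k \<ge> 2"
  shows "decidable_for_dfaos k (\<lambda>l. [l]) (\<lambda>l a. True)
      (\<lambda>l a. avoids (\<lambda>z. palindrome z \<and> length z \<ge> l) a)"
    and "decidable_for_dfaos k (\<lambda>l. [l]) (\<lambda>l a. True)
      (\<lambda>l a. \<forall>x. factor x a \<and> length x \<ge> l \<longrightarrow> \<not> factor (rev x) a)"
    and "decidable_for_dfaos k (\<lambda>j. [j]) (\<lambda>j a. range a \<subseteq> {..<j})
      (\<lambda>j a. avoids (\<lambda>z. \<exists>x. x \<noteq> [] \<and> z = x @ map (\<lambda>c. (c + 1) mod j) x) a)"
proof -
  have len: "length [l :: nat] = 1" for l by simp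
  have family: "input_family k (dfao_inputs k A) (dfao_input_code k (\<lambda>l. [l])) (Suc 1) (\<lambda>i. fst (snd i))" for A
    by (rule input_family_dfao[OF k len])
  have param: "input_family.computable_param (dfao_inputs k A) (dfao_input_code k (\<lambda>l. [l])) (Suc 1)
      (\<lambda>i. snd (snd i))" for A
    by (rule computable_param_dfao[OF family, of 0]) auto
  show "decidable_for_dfaos k (\<lambda>l. [l]) (\<lambda>l a. True) (\<lambda>l a. avoids (\<lambda>z. palindrome z \<and> length z \<ge> l) a)"
    by (rule decidable_if_definable[OF family len])
      (rule input_family.definable_avoids_palindromes[OF family param])
  show "decidable_for_dfaos k (\<lambda>l. [l]) (\<lambda>l a. True)
      (\<lambda>l a. \<forall>x. factor x a \<and> length x \<ge> l \<longrightarrow> \<not> factor (rev x) a)"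
    by (rule decidable_if_definable[OF family len])
      (rule input_family.definable_reversal_free[OF family param])
  show "decidable_for_dfaos k (\<lambda>j. [j]) (\<lambda>j a. range a \<subseteq> {..<j})
      (\<lambda>j a. avoids (\<lambda>z. \<exists>x. x \<noteq> [] \<and> z = x @ map (\<lambda>c. (c + 1) mod j) x) a)"
    by (rule decidable_if_definable[OF family len])
      (rule input_family.definable_avoids_shifted_squares[OF family param])
qed

lemma decidable_avoids_long_palindromes:
  assumes k: "k \<ge> 2"
  shows "decidable_for_dfaos k (\<lambda>_ :: unit. []) (\<lambda>_ a. True)
    (\<lambda>_ a. \<exists>L. avoids (\<lambda>z. palindrome z \<and> length z \<ge> L) a)"
proof -
  have family: "input_family k (dfao_inputs k (\<lambda>_ :: unit. \<lambda>a. True)) (dfao_input_code k (\<lambda>_. [])) (Suc 0) (\<lambda>i. fst (snd i))"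
    by (rule input_family_dfao[OF k]) simp
  show ?thesis
    by (rule decidable_if_definable[OF family])
      (simp, rule input_family.definable_avoids_long_palindromes[OF family])
qed

theorem theorem3:
  fixes k :: nat
  assumes "k \<ge> 2"
  shows
    "\<comment> \<open>(a)\<close>
     decidable_for_dfaos k rat_code (\<lambda>r a. r > 1)
       (\<lambda>r a. avoids (is_power (of_rat r)) a) \<and>
     decidable_for_dfaos k rat_code (\<lambda>r a. r > 1)
       (\<lambda>r a. avoids (is_plus_power (of_rat r)) a) \<and>
     \<comment> \<open>(b)\<close>
     decidable_for_dfaos k rat_code (\<lambda>r a. r > 1)
       (\<lambda>r a. infinite (occurrences (is_power (of_rat r)) a)) \<and>
     decidable_for_dfaos k rat_code (\<lambda>r a. r > 1)
       (\<lambda>r a. infinite (occurrences (is_plus_power (of_rat r)) a)) \<and>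
     \<comment> \<open>(c)\<close>
     decidable_for_dfaos k rat_code (\<lambda>r a. r > 1)
       (\<lambda>r a. infinite {z. factor z a \<and> is_power (of_rat r) z}) \<and>
     decidable_for_dfaos k rat_code (\<lambda>r a. r > 1)
       (\<lambda>r a. infinite {z. factor z a \<and> is_plus_power (of_rat r) z}) \<and>
     \<comment> \<open>(d)\<close>
     decidable_for_dfaos k (\<lambda>(r, l). rat_code r @ [l]) (\<lambda>(r, l) a. r > 1)
       (\<lambda>(r, l) a. avoids (\<lambda>z. \<exists>x. length x \<ge> l \<and> power_of (of_rat r) x z) a) \<and>
     decidable_for_dfaos k (\<lambda>(r, l). rat_code r @ [l]) (\<lambda>(r, l) a. r > 1)
       (\<lambda>(r, l) a. avoids (\<lambda>z. \<exists>x. length x \<ge> l \<and> plus_power_of (of_rat r) x z) a) \<and>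
     \<comment> \<open>(e)\<close>
     decidable_for_dfaos k rat_code (\<lambda>r a. r > 1)
       (\<lambda>r a. \<exists>L. \<forall>x. length x \<ge> L \<longrightarrow> avoids (power_of (of_rat r) x) a) \<and>
     \<comment> \<open>(f)\<close>
     decidable_for_dfaos k (\<lambda>l. [l]) (\<lambda>l a. True)
       (\<lambda>l a. avoids (\<lambda>z. palindrome z \<and> length z \<ge> l) a) \<and>
     \<comment> \<open>(g)\<close>
     decidable_for_dfaos k (\<lambda>_ :: unit. []) (\<lambda>_ a. True)
       (\<lambda>_ a. \<exists>L. avoids (\<lambda>z. palindrome z \<and> length z \<ge> L) a) \<and>
     \<comment> \<open>(h)\<close>
     decidable_for_dfaos k (\<lambda>l. [l]) (\<lambda>l a. True)
       (\<lambda>l a. \<forall>x. factor x a \<and> length x \<ge> l \<longrightarrow> \<not> factor (rev x) a) \<and>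
     \<comment> \<open>(i)\<close>
     decidable_for_dfaos k (\<lambda>j. [j]) (\<lambda>j a. range a \<subseteq> {..<j})
       (\<lambda>j a. avoids (\<lambda>z. \<exists>x. x \<noteq> [] \<and> z = x @ map (\<lambda>c. (c + 1) mod j) x) a)"
  \<comment> \<open>The summands \<open>+ 0\<close> and \<open>+ 1\<close> in the two
    characterizations instantiate \<open>c\<close>.\<close>
  using decidable_powers[OF assms occurs_at_power_of] decidable_powers[OF assms occurs_at_plus_power_of]
    decidable_with_length_param[OF assms] decidable_avoids_long_palindromes[OF assms]
  unfolding is_power_def[abs_def] is_plus_power_def[abs_def] by (intro conjI)

end
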